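(* Let $\mathscr G$ be an ample groupoid. Consider the statements: (1) there is a faithful invariant mean on $\mathscr G^{(0)}$; (2) there is a strongly faithful invariant mean on $\mathscr G^{(0)}$; (3) $\mathbb C\mathscr G$ admits a faithful $\Gamma_c(\mathscr G)$-contractive trace; (4) $\mathbb C\mathscr G$ admits a faithful trace. Then $(2)\implies(3)\implies(4)\implies(1)$. If $\mathscr G$ is Hausdorff, or more generally if the singular ideal $J_{\mathbb C}(\mathscr G)$ vanishes, then all four statements are equivalent.
   Context: A groupoid $\mathscr G$ is identified with its set of arrows, objects being identified with identity arrows; $\mathscr G^{(0)}$ is the unit space, $\boldsymbol d(\gamma)=\gamma^{-1}\gamma$, $\boldsymbol r(\gamma)=\gamma\gamma^{-1}$. A topological groupoid is étale if $\boldsymbol d$ is a local homeomorphism. An ample groupoid is an étale groupoid whose unit space is Hausdorff with a basis of compact open sets ($\mathscr G$ itself need not be Hausdorff). A bisection is an open subset $U\subseteq\mathscr G$ on which $\boldsymbol d$ and $\boldsymbol r$ are injective; $\Gamma(\mathscr G)$ (resp. $\Gamma_c(\mathscr G)$) is the set of open (resp. compact open) bisections, with setwise product and inverse, and $\Gamma_c(\mathscr G^{(0)})$ is the set of compact open subsets of $\mathscr G^{(0)}$. $\mathbb C\mathscr G$ is the span, inside the functions $\mathscr G\to\mathbb C$, of the indicator functions $1_U$, $U\in\Gamma_c(\mathscr G)$, with convolution product $(f\ast g)(\gamma)=\sum_{\alpha\beta=\gamma}f(\alpha)g(\beta)$ and involution $f^\ast(\gamma)=\overline{f(\gamma^{-1})}$.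 For $f\in\mathbb C\mathscr G$, $\mathrm{supp}(f)=\{\gamma\mid f(\gamma)\neq0\}$. The singular ideal is $J_{\mathbb C}(\mathscr G)=\{f\in\mathbb C\mathscr G\mid \mathrm{supp}(f)\text{ has empty interior}\}$. A mean on $\mathscr G^{(0)}$ is a map $\mu\colon\Gamma_c(\mathscr G^{(0)})\to[0,\infty)$ with $\mu(U\cup V)=\mu(U)+\mu(V)$ whenever $U\cap V=\emptyset$; it is invariant if $\mu(U^{-1}U)=\mu(UU^{-1})$ for all $U\in\Gamma_c(\mathscr G)$. Each invariant mean extends uniquely to an invariant measure, i.e., a (not necessarily finite) Radon measure $\mu$ on $\mathscr G^{(0)}$ with $\mu(U^{-1}U)=\mu(UU^{-1})$ for all $U\in\Gamma(\mathscr G)$; the extension is also denoted $\mu$. An invariant mean $\mu$ is faithful if $\mu(U)=0$ implies $U=\emptyset$ for all $U\in\Gamma_c(\mathscr G^{(0)})$; it is strongly faithful if (for the extended measure) $\mu(\boldsymbol r(\mathrm{supp}(f)))>0$ for each $0\neq f\in\mathbb C\mathscr G$ (the set $\boldsymbol r(\mathrm{supp}(f))$ is always Borel). A trace on a complex $\ast$-algebra $A$ is a linear functional $\tau\colon A\to\mathbb C$ with $\tau(ab)=\tau(ba)$, $\tau(a^\ast)=\overline{\tau(a)}$ and $\tau(aa^\ast)\geq 0$ for all $a,b\in A$; it is faithful if $\tau(aa^\ast)=0$ implies $a=0$. A trace $\tau$ on $\mathbb C\mathscr G$ is $\Gamma_c(\mathscr G)$-contractive if $\tau((f\ast 1_U)\ast(f\ast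 1_U)^\ast)\leq\tau(f\ast f^\ast)$ for all $f\in\mathbb C\mathscr G$ and $U\in\Gamma_c(\mathscr G)$. *)

theory Defs
  imports "HOL-Analysis.Analysis" "HOL-Library.Function_Algebras"
begin

section \<open>Ample groupoids\<close>

text \<open>A groupoid is a set of arrows with a partial product; the set of arrows is the underlying
  set of the topology field \<open>topol\<close>, and \<open>compos\<close> is the set of composable pairs.  The total
  functions \<open>mult\<close> and \<open>ginv\<close> are only meaningful on composable pairs and on arrows.\<close>

record 'a tgroupoid =
  topol :: "'a topology"
  compos :: "('a \<times> 'a) set"
  mult :: "'a \<Rightarrow> 'a \<Rightarrow> 'a"
  ginv :: "'a \<Rightarrow> 'a"

definition arrows :: "'a tgroupoid \<Rightarrow> 'a set" where
  "arrows G = topspace (topol G)"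

definition dom_map :: "'a tgroupoid \<Rightarrow> 'a \<Rightarrow> 'a" where
  "dom_map G \<gamma> = mult G (ginv G \<gamma>) \<gamma>"

definition ran_map :: "'a tgroupoid \<Rightarrow> 'a \<Rightarrow> 'a" where
  "ran_map G \<gamma> = mult G \<gamma> (ginv G \<gamma>)"

definition units :: "'a tgroupoid \<Rightarrow> 'a set" where
  "units G = dom_map G ` arrows G"

definition unit_space :: "'a tgroupoid \<Rightarrow> 'a topology" where
  "unit_space G = subtopology (topol G) (units G)"

text \<open>The standard arrows-only axioms (Hahn, Renault).  They imply that \<open>(\<alpha>, \<beta>)\<close> is composable
  iff the domain of \<open>\<alpha>\<close> is the range of \<open>\<beta>\<close>, see \<open>composable_iff\<close> below.\<close>

locale groupoid =
  fixes G :: "'a tgroupoid"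
  assumes compos_subset: "compos G \<subseteq> arrows G \<times> arrows G"
    and mult_closed: "(\<alpha>, \<beta>) \<in> compos G \<Longrightarrow> mult G \<alpha> \<beta> \<in> arrows G"
    and inv_closed: "\<gamma> \<in> arrows G \<Longrightarrow> ginv G \<gamma> \<in> arrows G"
    and inv_inv: "\<gamma> \<in> arrows G \<Longrightarrow> ginv G (ginv G \<gamma>) = \<gamma>"
    and assoc_compos: "(\<alpha>, \<beta>) \<in> compos G \<Longrightarrow> (\<beta>, \<gamma>) \<in> compos G \<Longrightarrow>
          (mult G \<alpha> \<beta>, \<gamma>) \<in> compos G \<and> (\<alpha>, mult G \<beta> \<gamma>) \<in> compos G"
    and assoc: "(\<alpha>, \<beta>) \<in> compos G \<Longrightarrow> (\<beta>, \<gamma>) \<in> compos G \<Longrightarrow>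
          mult G (mult G \<alpha> \<beta>) \<gamma> = mult G \<alpha> (mult G \<beta> \<gamma>)"
    and inv_compos: "\<gamma> \<in> arrows G \<Longrightarrow> (ginv G \<gamma>, \<gamma>) \<in> compos G"
    and cancel_left: "(\<alpha>, \<beta>) \<in> compos G \<Longrightarrow> mult G (ginv G \<alpha>) (mult G \<alpha> \<beta>) = \<beta>"
    and cancel_right: "(\<alpha>, \<beta>) \<in> compos G \<Longrightarrow> mult G (mult G \<alpha> \<beta>) (ginv G \<beta>) = \<alpha>"
begin

lemma inv_compos': "\<gamma> \<in> arrows G \<Longrightarrow> (\<gamma>, ginv G \<gamma>) \<in> compos G"
  using inv_compos[of "ginv G \<gamma>"] inv_closed[of \<gamma>] inv_inv[of \<gamma>] by simp

lemma mult_dom: "\<gamma> \<in> arrows G \<Longrightarrow> (\<gamma>, dom_map G \<gamma>) \<in> compos G \<and> mult G \<gamma> (dom_map G \<gamma>) = \<gamma>"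
  using assoc_compos[OF inv_compos' inv_compos, of \<gamma>] cancel_right[OF inv_compos', of \<gamma>]
    assoc[OF inv_compos' inv_compos, of \<gamma>] inv_inv[of \<gamma>]
  by (simp add: dom_map_def)

lemma ran_mult: "\<gamma> \<in> arrows G \<Longrightarrow> (ran_map G \<gamma>, \<gamma>) \<in> compos G \<and> mult G (ran_map G \<gamma>) \<gamma> = \<gamma>"
  using assoc_compos[OF inv_compos' inv_compos, of \<gamma>] cancel_right[OF inv_compos', of \<gamma>] inv_inv[of \<gamma>]
  by (simp add: ran_map_def)

lemma composable_iff:
  assumes "\<alpha> \<in> arrows G" "\<beta> \<in> arrows G"
  shows "(\<alpha>, \<beta>) \<in> compos G \<longleftrightarrow> dom_map G \<alpha> = ran_map G \<beta>"
proof
  assume ab: "(\<alpha>, \<beta>) \<in> compos G"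
  have "mult G (mult G (ginv G \<alpha>) (mult G \<alpha> \<beta>)) (ginv G \<beta>)
      = mult G (ginv G \<alpha>) (mult G (mult G \<alpha> \<beta>) (ginv G \<beta>))"
    using assoc[of "ginv G \<alpha>" "mult G \<alpha> \<beta>" "ginv G \<beta>"]
      assoc_compos[OF inv_compos[OF assms(1)] ab] assoc_compos[OF ab inv_compos'[OF assms(2)]]
    by blast
  then show "dom_map G \<alpha> = ran_map G \<beta>"
    by (simp add: dom_map_def ran_map_def cancel_left[OF ab] cancel_right[OF ab])
next
  assume "dom_map G \<alpha> = ran_map G \<beta>"
  then show "(\<alpha>, \<beta>) \<in> compos G"
    using mult_dom[OF assms(1)] ran_mult[OF assms(2)] assoc_compos by metis
qed

lemma ran_map_mult: "(\<alpha>, \<beta>) \<in> compos G \<Longrightarrow> ran_map G (mult G \<alpha> \<beta>) = ran_map G \<alpha>"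
proof -
  assume ab: "(\<alpha>, \<beta>) \<in> compos G"
  have arr: "\<alpha> \<in> arrows G" "mult G \<alpha> \<beta> \<in> arrows G"
    using ab compos_subset mult_closed by auto
  have "(ginv G \<alpha>, mult G \<alpha> \<beta>) \<in> compos G"
    using assoc_compos[OF inv_compos[OF arr(1)] ab] by blast
  then have "dom_map G (ginv G \<alpha>) = ran_map G (mult G \<alpha> \<beta>)"
    using composable_iff arr inv_closed by blast
  then show ?thesis
    by (simp add: dom_map_def ran_map_def inv_inv[OF arr(1)])
qed

end

locale topological_groupoid = groupoid +
  assumes continuous_mult:
      "continuous_map (subtopology (prod_topology (topol G) (topol G)) (compos G)) (topol G)
         (\<lambda>(\<alpha>, \<beta>). mult G \<alpha> \<beta>)"
    and continuous_inv: "continuous_map (topol G) (topol G) (ginv G)"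

definition local_homeomorphism_map :: "'a topology \<Rightarrow> 'b topology \<Rightarrow> ('a \<Rightarrow> 'b) \<Rightarrow> bool" where
  "local_homeomorphism_map X Y f \<longleftrightarrow> f \<in> topspace X \<rightarrow> topspace Y \<and>
     (\<forall>x\<in>topspace X. \<exists>U. openin X U \<and> x \<in> U \<and> openin Y (f ` U) \<and>
        homeomorphic_map (subtopology X U) (subtopology Y (f ` U)) f)"

locale etale_groupoid = topological_groupoid +
  assumes dom_local_homeo: "local_homeomorphism_map (topol G) (unit_space G) (dom_map G)"

locale ample_groupoid = etale_groupoid +
  assumes Hausdorff_units: "Hausdorff_space (unit_space G)"
    and compact_open_basis: "openin (unit_space G) U \<Longrightarrow>
          (arbitrary union_of (\<lambda>K. openin (unit_space G) K \<and> compactin (unit_space G) K)) U"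


section \<open>Bisections and the groupoid algebra\<close>

definition set_mult :: "'a tgroupoid \<Rightarrow> 'a set \<Rightarrow> 'a set \<Rightarrow> 'a set" where
  "set_mult G U V = {mult G \<alpha> \<beta> | \<alpha> \<beta>. \<alpha> \<in> U \<and> \<beta> \<in> V \<and> (\<alpha>, \<beta>) \<in> compos G}"

definition set_inv :: "'a tgroupoid \<Rightarrow> 'a set \<Rightarrow> 'a set" where
  "set_inv G U = ginv G ` U"

definition open_bisections :: "'a tgroupoid \<Rightarrow> 'a set set" where
  "open_bisections G =
     {U. openin (topol G) U \<and> inj_on (dom_map G) U \<and> inj_on (ran_map G) U}"

definition compact_bisections :: "'a tgroupoid \<Rightarrow> 'a set set" where
  "compact_bisections G = {U \<in> open_bisections G. compactin (topol G) U}"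

definition compact_open_units :: "'a tgroupoid \<Rightarrow> 'a set set" where
  "compact_open_units G = {U. openin (unit_space G) U \<and> compactin (unit_space G) U}"

definition fun_scale :: "complex \<Rightarrow> ('a \<Rightarrow> complex) \<Rightarrow> 'a \<Rightarrow> complex" where
  "fun_scale c f = (\<lambda>x. c * f x)"

interpretation complex_fun: vector_space fun_scale
  by standard (auto simp: fun_scale_def fun_eq_iff algebra_simps)

text \<open>Functions on the set of arrows are represented by functions on the ambient type that
  vanish outside it; all members of the span below do.\<close>

definition groupoid_algebra :: "'a tgroupoid \<Rightarrow> ('a \<Rightarrow> complex) set" where
  "groupoid_algebra G = complex_fun.span (indicator ` compact_bisections G)"

text \<open>The sum over all factorisations is restricted to the nonzero terms because \<open>sum\<close> over an
  infinite set is \<open>0\<close>; for members of the groupoid algebra only finitely many terms are nonzero,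
  see \<open>finite_convolution_terms\<close>.\<close>

definition convolution :: "'a tgroupoid \<Rightarrow> ('a \<Rightarrow> complex) \<Rightarrow> ('a \<Rightarrow> complex) \<Rightarrow> 'a \<Rightarrow> complex" where
  "convolution G f g \<gamma> =
     (\<Sum>(\<alpha>, \<beta>)\<in>{(\<alpha>, \<beta>) \<in> compos G. mult G \<alpha> \<beta> = \<gamma> \<and> f \<alpha> * g \<beta> \<noteq> 0}. f \<alpha> * g \<beta>)"

definition involution :: "'a tgroupoid \<Rightarrow> ('a \<Rightarrow> complex) \<Rightarrow> 'a \<Rightarrow> complex" where
  "involution G f \<gamma> = (if \<gamma> \<in> arrows G then cnj (f (ginv G \<gamma>)) else 0)"

definition supp :: "'a tgroupoid \<Rightarrow> ('a \<Rightarrow> complex) \<Rightarrow> 'a set" where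
  "supp G f = {\<gamma> \<in> arrows G. f \<gamma> \<noteq> 0}"

definition singular_ideal :: "'a tgroupoid \<Rightarrow> ('a \<Rightarrow> complex) set" where
  "singular_ideal G = {f \<in> groupoid_algebra G. topol G interior_of supp G f = {}}"

lemma groupoid_algebra_finite_cover:
  assumes "f \<in> groupoid_algebra G"
  obtains \<U> where "finite \<U>" "\<U> \<subseteq> compact_bisections G" "\<And>\<gamma>. f \<gamma> \<noteq> 0 \<Longrightarrow> \<exists>U\<in>\<U>. \<gamma> \<in> U"
proof -
  obtain t r where t: "finite t" "t \<subseteq> indicator ` compact_bisections G"
    and f: "f = (\<Sum>a\<in>t. fun_scale (r a) a)"
    using assms unfolding groupoid_algebra_def complex_fun.span_explicit by blast
  obtain \<U> where U: "\<U> \<subseteq> compact_bisections G" "finite \<U>" "t = indicator ` \<U>"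
    using finite_subset_image[OF t] by blast
  have eval: "(\<Sum>a\<in>s. h a) x = (\<Sum>a\<in>s. h a x)" for s x and h :: "('a \<Rightarrow> complex) \<Rightarrow> 'a \<Rightarrow> complex"
    by (induction s rule: infinite_finite_induct) auto
  have "\<exists>U\<in>\<U>. \<gamma> \<in> U" if "f \<gamma> \<noteq> 0" for \<gamma>
  proof -
    have "(\<Sum>a\<in>t. fun_scale (r a) a \<gamma>) \<noteq> 0"
      using that eval[of "\<lambda>a. fun_scale (r a) a" t \<gamma>] f by simp
    then obtain a where "a \<in> t" "fun_scale (r a) a \<gamma> \<noteq> 0"
      by (meson sum.neutral)
    then show ?thesis
      using U(3) by (auto simp: fun_scale_def indicator_def split: if_splits)
  qed
  then show ?thesis
    using that U by blast
qed

lemma (in groupoid) finite_convolution_terms: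
  assumes "f \<in> groupoid_algebra G"
  shows "finite {(\<alpha>, \<beta>) \<in> compos G. mult G \<alpha> \<beta> = \<gamma> \<and> f \<alpha> * g \<beta> \<noteq> 0}" (is "finite ?S")
proof -
  obtain \<U> where U: "finite \<U>" "\<U> \<subseteq> compact_bisections G" "\<And>\<gamma>. f \<gamma> \<noteq> 0 \<Longrightarrow> \<exists>U\<in>\<U>. \<gamma> \<in> U"
    using groupoid_algebra_finite_cover[OF assms] by metis
  let ?A = "\<Union>U\<in>\<U>. {\<alpha> \<in> U. ran_map G \<alpha> = ran_map G \<gamma>}"
  have fin: "finite {\<alpha> \<in> U. ran_map G \<alpha> = ran_map G \<gamma>}" if "U \<in> \<U>" for U
  proof -
    have "inj_on (ran_map G) U"
      using that U(2) by (auto simp: compact_bisections_def open_bisections_def)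
    then have "inj_on (ran_map G) {\<alpha> \<in> U. ran_map G \<alpha> = ran_map G \<gamma>}"
      by (rule inj_on_subset) auto
    moreover have "finite (ran_map G ` {\<alpha> \<in> U. ran_map G \<alpha> = ran_map G \<gamma>})"
      by (rule finite_subset[of _ "{ran_map G \<gamma>}"]) auto
    ultimately show ?thesis
      using finite_imageD by blast
  qed
  have "?S \<subseteq> (\<lambda>\<alpha>. (\<alpha>, mult G (ginv G \<alpha>) \<gamma>)) ` ?A"
  proof clarify
    fix \<alpha> \<beta>
    assume ab: "(\<alpha>, \<beta>) \<in> compos G" and \<gamma>: "\<gamma> = mult G \<alpha> \<beta>" and nz: "f \<alpha> * g \<beta> \<noteq> 0"
    obtain V where "V \<in> \<U>" "\<alpha> \<in> V"
      using U(3)[of \<alpha>] nz by auto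
    then have "\<alpha> \<in> (\<Union>U\<in>\<U>. {\<alpha>' \<in> U. ran_map G \<alpha>' = ran_map G (mult G \<alpha> \<beta>)})"
      using ran_map_mult[OF ab] by (intro UN_I[of V]) auto
    then show "(\<alpha>, \<beta>) \<in> (\<lambda>\<alpha>'. (\<alpha>', mult G (ginv G \<alpha>') (mult G \<alpha> \<beta>))) `
        (\<Union>U\<in>\<U>. {\<alpha>' \<in> U. ran_map G \<alpha>' = ran_map G (mult G \<alpha> \<beta>)})"
      by (rule image_eqI[rotated]) (simp add: cancel_left[OF ab])
  qed
  moreover have "finite ?A"
    using U(1) fin by blast
  ultimately show ?thesis
    using finite_subset[OF _ finite_imageI] by blast
qed


section \<open>Invariant means and measures\<close>

definition invariant_mean :: "'a tgroupoid \<Rightarrow> ('a set \<Rightarrow> real) \<Rightarrow> bool" where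
  "invariant_mean G \<mu> \<longleftrightarrow>
     (\<forall>U\<in>compact_open_units G. 0 \<le> \<mu> U) \<and>
     (\<forall>U\<in>compact_open_units G. \<forall>V\<in>compact_open_units G.
        U \<inter> V = {} \<longrightarrow> \<mu> (U \<union> V) = \<mu> U + \<mu> V) \<and>
     (\<forall>U\<in>compact_bisections G. \<mu> (set_mult G (set_inv G U) U) = \<mu> (set_mult G U (set_inv G U)))"

definition faithful_mean :: "'a tgroupoid \<Rightarrow> ('a set \<Rightarrow> real) \<Rightarrow> bool" where
  "faithful_mean G \<mu> \<longleftrightarrow> (\<forall>U\<in>compact_open_units G. \<mu> U = 0 \<longrightarrow> U = {})"

text \<open>Radon measures on a locally compact Hausdorff space: Borel measures that are finite on
  compact sets, outer regular on Borel sets and inner regular on open sets.\<close>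

definition radon_measure :: "'a topology \<Rightarrow> 'a measure \<Rightarrow> bool" where
  "radon_measure X M \<longleftrightarrow>
     space M = topspace X \<and> sets M = sigma_sets (topspace X) {U. openin X U} \<and>
     (\<forall>K. compactin X K \<longrightarrow> emeasure M K < \<infinity>) \<and>
     (\<forall>A\<in>sets M. emeasure M A = (INF U\<in>{U. openin X U \<and> A \<subseteq> U}. emeasure M U)) \<and>
     (\<forall>U. openin X U \<longrightarrow> emeasure M U = (SUP K\<in>{K. compactin X K \<and> K \<subseteq> U}. emeasure M K))"

definition invariant_measure :: "'a tgroupoid \<Rightarrow> 'a measure \<Rightarrow> bool" where
  "invariant_measure G M \<longleftrightarrow> radon_measure (unit_space G) M \<and>
     (\<forall>U\<in>open_bisections G.
        emeasure M (set_mult G (set_inv G U) U) = emeasure M (set_mult G U (set_inv G U)))"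

definition extends_mean :: "'a tgroupoid \<Rightarrow> 'a measure \<Rightarrow> ('a set \<Rightarrow> real) \<Rightarrow> bool" where
  "extends_mean G M \<mu> \<longleftrightarrow> (\<forall>U\<in>compact_open_units G. emeasure M U = ennreal (\<mu> U))"

text \<open>The invariant measure \<open>M\<close> extending \<open>\<mu>\<close> is unique, see \<open>extension_unique\<close>.\<close>

definition strongly_faithful_mean :: "'a tgroupoid \<Rightarrow> ('a set \<Rightarrow> real) \<Rightarrow> bool" where
  "strongly_faithful_mean G \<mu> \<longleftrightarrow>
     (\<exists>M. invariant_measure G M \<and> extends_mean G M \<mu> \<and>
        (\<forall>f\<in>groupoid_algebra G. f \<noteq> 0 \<longrightarrow> emeasure M (ran_map G ` supp G f) > 0))"

lemma (in ample_groupoid) compact_open_between: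
  assumes "compactin (unit_space G) K" "openin (unit_space G) U" "K \<subseteq> U"
  obtains C where "C \<in> compact_open_units G" "K \<subseteq> C" "C \<subseteq> U"
proof -
  let ?P = "\<lambda>K. openin (unit_space G) K \<and> compactin (unit_space G) K"
  obtain \<U> where U: "\<U> \<subseteq> Collect ?P" "\<Union>\<U> = U"
    using compact_open_basis[OF assms(2)] unfolding union_of_def by auto
  have "\<And>V. V \<in> \<U> \<Longrightarrow> openin (unit_space G) V"
    using U(1) by blast
  moreover have "K \<subseteq> \<Union>\<U>"
    using assms(3) U(2) by simp
  ultimately obtain \<F> where F: "finite \<F>" "\<F> \<subseteq> \<U>" "K \<subseteq> \<Union>\<F>"
    using compactinD[OF assms(1), of \<U>] by metis
  have "openin (unit_space G) (\<Union>\<F>)"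
    using F U by (intro openin_Union) auto
  moreover have "compactin (unit_space G) (\<Union>\<F>)"
    using F U by (intro compactin_Union) auto
  ultimately have "\<Union>\<F> \<in> compact_open_units G"
    by (simp add: compact_open_units_def)
  then show ?thesis
    using that F U by blast
qed

lemma (in ample_groupoid) extension_unique:
  assumes "invariant_measure G M" "extends_mean G M \<mu>"
    and "invariant_measure G N" "extends_mean G N \<mu>"
  shows "M = N"
proof (rule measure_eqI)
  show sets: "sets M = sets N"
    using assms(1,3) unfolding invariant_measure_def radon_measure_def by metis
  have openS: "emeasure M U = (SUP C\<in>{C \<in> compact_open_units G. C \<subseteq> U}. ennreal (\<mu> C))"
    if M: "invariant_measure G M" "extends_mean G M \<mu>" and U: "openin (unit_space G) U" for M U
  proof -
    have "emeasure M U = (SUP K\<in>{K. compactin (unit_space G) K \<and> K \<subseteq> U}. emeasure M K)"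
      using M U unfolding invariant_measure_def radon_measure_def by blast
    also have "\<dots> = (SUP C\<in>{C \<in> compact_open_units G. C \<subseteq> U}. emeasure M C)"
    proof (rule antisym; rule SUP_mono)
      fix K assume K: "K \<in> {K. compactin (unit_space G) K \<and> K \<subseteq> U}"
      obtain C where C: "C \<in> compact_open_units G" "K \<subseteq> C" "C \<subseteq> U"
        using compact_open_between[OF _ U, of K] K by blast
      have "openin (unit_space G) C"
        using C(1) by (simp add: compact_open_units_def)
      then have "C \<in> sets M"
        using M(1) unfolding invariant_measure_def radon_measure_def by blast
      then show "\<exists>C\<in>{C \<in> compact_open_units G. C \<subseteq> U}. emeasure M K \<le> emeasure M C"
        using C by (auto intro!: bexI[of _ C] emeasure_mono)
    qed (auto simp: compact_open_units_def)
    also have "\<dots> = (SUP C\<in>{C \<in> compact_open_units G. C \<subseteq> U}. ennreal (\<mu> C))"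
      using M(2) by (intro SUP_cong) (auto simp: extends_mean_def)
    finally show ?thesis .
  qed
  fix A assume A: "A \<in> sets M"
  have "emeasure M A = (INF U\<in>{U. openin (unit_space G) U \<and> A \<subseteq> U}. emeasure M U)"
    using A assms(1) unfolding invariant_measure_def radon_measure_def by blast
  also have "\<dots> = (INF U\<in>{U. openin (unit_space G) U \<and> A \<subseteq> U}. emeasure N U)"
    using openS assms by (intro INF_cong) auto
  also have "\<dots> = emeasure N A"
    using A sets assms(3) unfolding invariant_measure_def radon_measure_def by (metis (no_types, lifting))
  finally show "emeasure M A = emeasure N A" .
qed


section \<open>Traces\<close>

text \<open>Traces on a complex \<open>*\<close>-algebra given by its carrier, scalar multiplication, product and
  involution.  The order is that of \<^theory>\<open>HOL-Library.Complex_Order\<close>: \<open>0 \<le> z\<close> means that \<open>z\<close> is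
  real and nonnegative.  Only the values of \<open>\<tau>\<close> on the carrier are relevant.\<close>

definition is_trace :: "'b set \<Rightarrow> (complex \<Rightarrow> 'b \<Rightarrow> 'b) \<Rightarrow> ('b \<Rightarrow> 'b \<Rightarrow> 'b) \<Rightarrow> ('b \<Rightarrow> 'b) \<Rightarrow>
    ('b::ab_group_add \<Rightarrow> complex) \<Rightarrow> bool" where
  "is_trace A smul prd star \<tau> \<longleftrightarrow>
     (\<forall>a\<in>A. \<forall>b\<in>A. \<tau> (a + b) = \<tau> a + \<tau> b) \<and>
     (\<forall>c. \<forall>a\<in>A. \<tau> (smul c a) = c * \<tau> a) \<and>
     (\<forall>a\<in>A. \<forall>b\<in>A. \<tau> (prd a b) = \<tau> (prd b a)) \<and>
     (\<forall>a\<in>A. \<tau> (star a) = cnj (\<tau> a)) \<and>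
     (\<forall>a\<in>A. 0 \<le> \<tau> (prd a (star a)))"

definition groupoid_trace :: "'a tgroupoid \<Rightarrow> (('a \<Rightarrow> complex) \<Rightarrow> complex) \<Rightarrow> bool" where
  "groupoid_trace G \<tau> \<longleftrightarrow>
     is_trace (groupoid_algebra G) fun_scale (convolution G) (involution G) \<tau>"

definition faithful_trace :: "'a tgroupoid \<Rightarrow> (('a \<Rightarrow> complex) \<Rightarrow> complex) \<Rightarrow> bool" where
  "faithful_trace G \<tau> \<longleftrightarrow>
     (\<forall>f\<in>groupoid_algebra G. \<tau> (convolution G f (involution G f)) = 0 \<longrightarrow> f = 0)"

definition contractive_trace :: "'a tgroupoid \<Rightarrow> (('a \<Rightarrow> complex) \<Rightarrow> complex) \<Rightarrow> bool" where
  "contractive_trace G \<tau> \<longleftrightarrow>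
     (\<forall>f\<in>groupoid_algebra G. \<forall>U\<in>compact_bisections G.
        \<tau> (convolution G (convolution G f (indicator U)) (involution G (convolution G f (indicator U))))
          \<le> \<tau> (convolution G f (involution G f)))"

end

theory Submission
  imports Defs
begin

text \<open>From an invariant measure \<open>M\<close> one gets the trace \<open>\<tau>(f) = \<integral>f dM\<close> over the unit space.  Its value at
  \<open>f * f\<^sup>*\<close> is the integral of the fibre energy \<open>x \<mapsto> \<Sum>|f(\<alpha>)|\<^sup>2\<close>, summed over the arrows \<open>\<alpha>\<close> with range
  \<open>x\<close>, which is nonzero exactly on the range of the support of \<open>f\<close>; so strong faithfulness of the mean
  is faithfulness of \<open>\<tau>\<close>.  Multiplication by \<open>1\<^sub>U\<close> permutes part of each fibre and discards the rest,
  hence contractivity already holds pointwise.  Conversely, a faithful trace restricts to a faithful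
  invariant mean \<open>U \<mapsto> \<tau>(1\<^sub>U)\<close>.  Finally, an invariant mean extends to an invariant Radon measure by
  Caratheodory's construction, invariance being checked on compact open subsets; if the singular
  ideal vanishes, the support of \<open>f \<noteq> 0\<close> has nonempty interior, whose range is open and nonempty
  and so has positive measure.\<close>


section \<open>Extending a mean on compact open sets to a Radon measure\<close>

text \<open>Only the topology of the unit space enters the construction of the measure, so it is
  carried out for any Hausdorff space with a basis of compact open sets.\<close>

locale compact_open_mean =
  fixes X :: "'a topology" and \<mu> :: "'a set \<Rightarrow> real"
  assumes Hausdorff: "Hausdorff_space X"
    and basis: "openin X U \<Longrightarrow> x \<in> U \<Longrightarrow> \<exists>C. openin X C \<and> compactin X C \<and> x \<in> C \<and> C \<subseteq> U"
    and nonneg: "openin X C \<Longrightarrow> compactin X C \<Longrightarrow> 0 \<le> \<mu> C"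
    and additive: "openin X C \<Longrightarrow> compactin X C \<Longrightarrow> openin X D \<Longrightarrow> compactin X D \<Longrightarrow>
          C \<inter> D = {} \<Longrightarrow> \<mu> (C \<union> D) = \<mu> C + \<mu> D"
begin

definition compact_opens :: "'a set set" where
  "compact_opens = {C. openin X C \<and> compactin X C}"

text \<open>The supremum for open sets and the infimum in \<open>outer_value\<close> are chosen so
  that inner regularity on open sets and outer regularity, as demanded by
  \<open>radon_measure\<close>, are built in.\<close>

definition open_value :: "'a set \<Rightarrow> ennreal" where
  "open_value U = (SUP C\<in>{C \<in> compact_opens. C \<subseteq> U}. ennreal (\<mu> C))"

definition outer_value :: "'a set \<Rightarrow> ennreal" where
  "outer_value A = (INF U\<in>{U. openin X U \<and> A \<subseteq> U}. open_value U)"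

lemma compact_opens_empty: "{} \<in> compact_opens"
  by (simp add: compact_opens_def)

lemma compact_opens_Un: "C \<in> compact_opens \<Longrightarrow> D \<in> compact_opens \<Longrightarrow> C \<union> D \<in> compact_opens"
  by (auto simp: compact_opens_def compactin_Un)

lemma openin_diff_compact: "openin X U \<Longrightarrow> compactin X C \<Longrightarrow> openin X (U - C)"
  by (simp add: Hausdorff compactin_imp_closedin openin_diff)

text \<open>In a Hausdorff space compact sets are closed, so the difference is open, and it is
  compact as a closed subset of \<open>C\<close>. Thus the compact open sets form a ring of sets and
  \<open>\<mu>\<close> a finitely additive content on it.\<close>

lemma compact_opens_Diff:
  assumes "C \<in> compact_opens" "D \<in> compact_opens"
  shows "C - D \<in> compact_opens"
proof -
  have "closedin X (C - D)"
    using assms Hausdorff compactin_imp_closedin by (auto simp: compact_opens_def)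
  then have "compactin X (C - D)"
    using assms closed_compactin[of X C "C - D"] by (auto simp: compact_opens_def)
  then show ?thesis
    using assms openin_diff_compact by (auto simp: compact_opens_def)
qed

lemma mean_add:
  "C \<in> compact_opens \<Longrightarrow> D \<in> compact_opens \<Longrightarrow> C \<inter> D = {} \<Longrightarrow>
     ennreal (\<mu> (C \<union> D)) = ennreal (\<mu> C) + ennreal (\<mu> D)"
  using additive nonneg by (simp add: compact_opens_def)

lemma mean_empty: "\<mu> {} = 0"
  using additive[of "{}" "{}"] by simp

lemma mean_mono:
  assumes "C \<in> compact_opens" "D \<in> compact_opens" "C \<subseteq> D"
  shows "ennreal (\<mu> C) \<le> ennreal (\<mu> D)"
  using mean_add[OF assms(1) compact_opens_Diff[OF assms(2,1)]] assms(3)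
  by (simp add: Un_absorb1)

lemma mean_le_open_value: "C \<in> compact_opens \<Longrightarrow> C \<subseteq> U \<Longrightarrow> ennreal (\<mu> C) \<le> open_value U"
  unfolding open_value_def by (rule SUP_upper) simp

lemma open_value_le:
  "(\<And>C. C \<in> compact_opens \<Longrightarrow> C \<subseteq> U \<Longrightarrow> ennreal (\<mu> C) \<le> b) \<Longrightarrow> open_value U \<le> b"
  unfolding open_value_def by (rule SUP_least) simp

lemma open_value_compact_open: "C \<in> compact_opens \<Longrightarrow> open_value C = ennreal (\<mu> C)"
  by (intro antisym open_value_le mean_le_open_value mean_mono) auto

lemma open_value_mono: "U \<subseteq> V \<Longrightarrow> open_value U \<le> open_value V"
  by (intro open_value_le mean_le_open_value) auto

text \<open>Finitely many compact open sets inside \<open>U\<close> cover \<open>K\<close>, and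
  their union is again compact open. This is how arbitrary compact sets are brought within reach of
  \<open>\<mu>\<close>.\<close>

lemma compact_open_cover:
  assumes K: "compactin X K" and U: "openin X U" "K \<subseteq> U"
  obtains C where "C \<in> compact_opens" "K \<subseteq> C" "C \<subseteq> U"
proof -
  let ?\<U> = "{C \<in> compact_opens. C \<subseteq> U}"
  have "K \<subseteq> \<Union>?\<U>"
    using basis[OF U(1)] U(2) by (fastforce simp: compact_opens_def)
  moreover have "\<And>V. V \<in> ?\<U> \<Longrightarrow> openin X V"
    by (simp add: compact_opens_def)
  ultimately have "\<exists>\<F>. finite \<F> \<and> \<F> \<subseteq> ?\<U> \<and> K \<subseteq> \<Union>\<F>"
    by (intro compactinD[OF K])
  then obtain \<F> where F: "finite \<F>" "\<F> \<subseteq> ?\<U>" "K \<subseteq> \<Union>\<F>"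
    by (elim exE conjE)
  have "openin X (\<Union>\<F>)" "compactin X (\<Union>\<F>)"
    using F by (auto simp: compact_opens_def intro!: compactin_Union)
  then show ?thesis
    using that[of "\<Union>\<F>"] F by (auto simp: compact_opens_def)
qed

text \<open>The part of a compact open \<open>C\<close> outside \<open>V\<close> is compact and lies
  in \<open>U\<close>, so it can be enclosed in a compact open \<open>D\<close> inside
  \<open>U \<inter> C\<close>. Then \<open>C\<close> splits into \<open>D\<close>, which lies in
  \<open>U\<close>, and \<open>C - D\<close>, which lies in \<open>V\<close>.\<close>

lemma open_value_Un:
  assumes U: "openin X U" and V: "openin X V"
  shows "open_value (U \<union> V) \<le> open_value U + open_value V"
proof (rule open_value_le)
  fix C assume C: "C \<in> compact_opens" "C \<subseteq> U \<union> V"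
  have "closedin X (topspace X - V)"
    using V by blast
  then have "compactin X ((topspace X - V) \<inter> C)"
    using C(1) closed_Int_compactin by (auto simp: compact_opens_def)
  moreover have "(topspace X - V) \<inter> C \<subseteq> U \<inter> C"
    using C(2) by blast
  moreover have "openin X (U \<inter> C)"
    using U C(1) by (simp add: compact_opens_def openin_Int)
  ultimately obtain D where D: "D \<in> compact_opens" "(topspace X - V) \<inter> C \<subseteq> D" "D \<subseteq> U \<inter> C"
    using compact_open_cover by metis
  have "C \<subseteq> topspace X"
    using C(1) openin_subset by (auto simp: compact_opens_def)
  then have CD: "C - D \<in> compact_opens" "C - D \<subseteq> V"
    using compact_opens_Diff[OF C(1) D(1)] D(2) by auto
  have "ennreal (\<mu> C) = ennreal (\<mu> D) + ennreal (\<mu> (C - D))"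
    using mean_add[OF D(1) CD(1)] D(3) by (simp add: Un_absorb1 le_infI2)
  also have "\<dots> \<le> open_value U + open_value V"
    using D CD by (intro add_mono mean_le_open_value) auto
  finally show "ennreal (\<mu> C) \<le> open_value U + open_value V" .
qed

lemma open_value_empty: "open_value {} = 0"
  using open_value_compact_open[OF compact_opens_empty] mean_empty by simp

lemma open_value_finite_Union:
  assumes "\<And>i::nat. openin X (U i)"
  shows "open_value (\<Union>i<n. U i) \<le> (\<Sum>i<n. open_value (U i))"
proof (induction n)
  case 0
  then show ?case by (simp add: open_value_empty)
next
  case (Suc n)
  have "open_value (\<Union>i<Suc n. U i) = open_value ((\<Union>i<n. U i) \<union> U n)"
    by (simp add: lessThan_Suc Un_commute)
  also have "\<dots> \<le> open_value (\<Union>i<n. U i) + open_value (U n)"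
    using assms by (intro open_value_Un) auto
  also have "\<dots> \<le> (\<Sum>i<Suc n. open_value (U i))"
    using Suc.IH by (simp add: add_right_mono)
  finally show ?case .
qed

text \<open>Each compact open set inside the union is already covered by finitely many of the
  \<open>U i\<close>, so finite subadditivity suffices.\<close>

lemma open_value_countable_Union:
  assumes U: "\<And>i::nat. openin X (U i)"
  shows "open_value (\<Union>i. U i) \<le> (\<Sum>i. open_value (U i))"
proof (rule open_value_le)
  fix C assume C: "C \<in> compact_opens" "C \<subseteq> (\<Union>i. U i)"
  then obtain \<F> where F: "finite \<F>" "\<F> \<subseteq> range U" "C \<subseteq> \<Union>\<F>"
    using compactinD[of X C "range U"] U by (auto simp: compact_opens_def)
  obtain I where I: "finite I" "\<F> = U ` I"
    using F(1,2) by (meson finite_subset_image)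
  obtain n where "I \<subseteq> {..<n}"
    using I(1) finite_nat_iff_bounded by blast
  then have "C \<subseteq> (\<Union>i<n. U i)"
    using F(3) I(2) by blast
  then have "ennreal (\<mu> C) \<le> open_value (\<Union>i<n. U i)"
    using C(1) mean_le_open_value by blast
  also have "\<dots> \<le> (\<Sum>i<n. open_value (U i))"
    using open_value_finite_Union[OF U] .
  also have "\<dots> \<le> (\<Sum>i. open_value (U i))"
    by (rule sum_le_suminf) auto
  finally show "ennreal (\<mu> C) \<le> (\<Sum>i. open_value (U i))" .
qed

section \<open>The outer measure and measurability of open sets\<close>

lemma outer_value_le: "openin X U \<Longrightarrow> A \<subseteq> U \<Longrightarrow> outer_value A \<le> open_value U"
  unfolding outer_value_def by (rule INF_lower) simp

lemma outer_value_ge: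
  "(\<And>U. openin X U \<Longrightarrow> A \<subseteq> U \<Longrightarrow> b \<le> open_value U) \<Longrightarrow> b \<le> outer_value A"
  unfolding outer_value_def by (rule INF_greatest) simp

lemma outer_value_open: "openin X U \<Longrightarrow> outer_value U = open_value U"
  by (intro antisym outer_value_le outer_value_ge open_value_mono) auto

lemma outer_value_mono: "A \<subseteq> B \<Longrightarrow> outer_value A \<le> outer_value B"
  by (intro outer_value_ge outer_value_le) auto

text \<open>Each \<open>A i\<close> is enclosed in an open set whose value exceeds the outer value
  by less than \<open>e * (1/2)^Suc i\<close>; these errors add up to \<open>e\<close>. The strict
  inequality requires finite outer values, hence the case distinction.\<close>

lemma outer_value_countable_Union: "outer_value (\<Union>i. A i) \<le> (\<Sum>i::nat. outer_value (A i))"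
proof (cases "(\<Sum>i. outer_value (A i)) = top")
  case False
  show ?thesis
  proof (rule ennreal_le_epsilon)
    fix e :: real assume e: "0 < e"
    have fin: "outer_value (A i) < top" for i
      using False ennreal_suminf_lessD[of "\<lambda>i. outer_value (A i)" top i] by (simp add: top.not_eq_extremum)
    have "\<exists>U. openin X U \<and> A i \<subseteq> U \<and> open_value U < outer_value (A i) + ennreal (e * (1/2)^Suc i)"
      for i
    proof -
      have "outer_value (A i) < outer_value (A i) + ennreal (e * (1/2)^Suc i)"
        using fin[of i] e by (simp add: ennreal_zero_less_mult_iff less_top)
      then show ?thesis
        unfolding outer_value_def INF_less_iff by auto
    qed
    then obtain U where U: "\<And>i. openin X (U i)" "\<And>i. A i \<subseteq> U i"
      "\<And>i. open_value (U i) < outer_value (A i) + ennreal (e * (1/2)^Suc i)"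
      by metis
    have "outer_value (\<Union>i. A i) \<le> open_value (\<Union>i. U i)"
      using U(1,2) by (intro outer_value_le) auto
    also have "\<dots> \<le> (\<Sum>i. open_value (U i))"
      by (rule open_value_countable_Union[OF U(1)])
    also have "\<dots> \<le> (\<Sum>i. outer_value (A i) + ennreal (e * (1/2)^Suc i))"
      using U(3) by (intro suminf_le) (auto intro: less_imp_le)
    also have "\<dots> = (\<Sum>i. outer_value (A i)) + (\<Sum>i. ennreal (e * (1/2)^Suc i))"
      by (rule suminf_add[symmetric]) auto
    also have "(\<Sum>i. ennreal (e * (1/2)^Suc i)) = ennreal e"
      using sums_mult[OF power_half_series, of e] e
      by (subst suminf_ennreal_eq[of _ e]) auto
    finally show "outer_value (\<Union>i. A i) \<le> (\<Sum>i. outer_value (A i)) + ennreal e" .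
  qed
qed simp

lemma outer_value_empty: "outer_value {} = 0"
  by (simp add: outer_value_open open_value_empty)

lemma outer_measure_space_outer_value: "outer_measure_space (Pow (topspace X)) outer_value"
  by (auto simp: outer_measure_space_def positive_def increasing_def countably_subadditive_def
      outer_value_empty outer_value_countable_Union outer_value_mono)

lemma outer_value_Un: "outer_value (A \<union> B) \<le> outer_value A + outer_value B"
proof -
  have "outer_value (A \<union> B) \<le> (\<Sum>i. outer_value (binaryset A B i))"
    using outer_value_countable_Union[of "binaryset A B"] by (simp add: UN_binaryset_eq)
  also have "\<dots> = outer_value A + outer_value B"
    by (rule suminf_binaryset_eq) (rule outer_value_empty)
  finally show ?thesis .
qed

text \<open>The set \<open>A\<close> may be tested through an open \<open>V\<close> containing it.
  Disjoint compact open sets \<open>C\<close> inside \<open>V \<inter> U\<close> and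
  \<open>D\<close> inside \<open>V - C\<close> satisfy
  \<open>\<mu> C + \<mu> D \<le> open_value V\<close>, and one passes to the supremum over
  \<open>D\<close> first and then over \<open>C\<close>.\<close>

lemma open_in_lambda_system:
  assumes U: "openin X U"
  shows "U \<in> lambda_system (topspace X) (Pow (topspace X)) outer_value"
proof -
  interpret sigma_algebra "topspace X" "Pow (topspace X)"
    by (rule sigma_algebra_Pow)
  have "outer_value (A \<inter> U) + outer_value (A - U) = outer_value A" for A
  proof (rule antisym)
    show "outer_value A \<le> outer_value (A \<inter> U) + outer_value (A - U)"
      using outer_value_Un[of "A \<inter> U" "A - U"] by (simp add: Int_Diff_Un)
    show "outer_value (A \<inter> U) + outer_value (A - U) \<le> outer_value A"
    proof (rule outer_value_ge)
      fix V assume V: "openin X V" "A \<subseteq> V"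
      \<comment> \<open>Here \<open>C\<close> is fixed and \<open>D\<close> varies. The set
        \<open>V - C\<close> is open because \<open>C\<close> is closed, and it contains
        \<open>V - U\<close> because \<open>C\<close> lies in \<open>U\<close>, so its value
        dominates the outer value of \<open>V - U\<close>.\<close>
      have bound: "ennreal (\<mu> C) + outer_value (V - U) \<le> open_value V"
        if C: "C \<in> compact_opens" "C \<subseteq> V \<inter> U" for C
      proof -
        have "ennreal (\<mu> C) + ennreal (\<mu> D) \<le> open_value V"
          if "D \<in> compact_opens" "D \<subseteq> V - C" for D
        proof -
          have "C \<inter> D = {}" "C \<union> D \<subseteq> V"
            using that(2) C(2) by auto
          then show ?thesis
            using mean_add[OF C(1) that(1)] mean_le_open_value[OF compact_opens_Un[OF C(1) that(1)]]
            by metis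
        qed
        then have "(SUP D\<in>{D \<in> compact_opens. D \<subseteq> V - C}. ennreal (\<mu> C) + ennreal (\<mu> D)) \<le> open_value V"
          by (intro SUP_least) auto
        \<comment> \<open>Adding a constant commutes with a supremum only over a nonempty family,
          since the empty supremum is 0.\<close>
        moreover have "{D \<in> compact_opens. D \<subseteq> V - C} \<noteq> {}"
          using compact_opens_empty by blast
        ultimately have "ennreal (\<mu> C) + open_value (V - C) \<le> open_value V"
          unfolding open_value_def[of "V - C"] by (simp add: ennreal_SUP_add_right)
        moreover have "outer_value (V - U) \<le> open_value (V - C)"
          using C V by (intro outer_value_le openin_diff_compact) (auto simp: compact_opens_def)
        ultimately show ?thesis
          by (meson add_left_mono order_trans)
      qed
      have ne: "{C \<in> compact_opens. C \<subseteq> V \<inter> U} \<noteq> {}"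
        using compact_opens_empty by blast
      \<comment> \<open>Now \<open>C\<close> varies, and its values have the supremum
        \<open>open_value (V \<inter> U)\<close>.\<close>
      have "(SUP C\<in>{C \<in> compact_opens. C \<subseteq> V \<inter> U}. outer_value (V - U) + ennreal (\<mu> C)) \<le> open_value V"
        using bound by (intro SUP_least) (auto simp: add.commute)
      then have "outer_value (V - U) + open_value (V \<inter> U) \<le> open_value V"
        unfolding open_value_def[of "V \<inter> U"] by (simp only: ennreal_SUP_add_right[OF ne])
      moreover have "outer_value (A \<inter> U) \<le> open_value (V \<inter> U)"
        using U V by (intro outer_value_le) auto
      moreover have "outer_value (A - U) \<le> outer_value (V - U)"
        using V by (intro outer_value_mono) auto
      ultimately show "outer_value (A \<inter> U) + outer_value (A - U) \<le> open_value V"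
        using add_mono[of "outer_value (A - U)" "outer_value (V - U)"
            "outer_value (A \<inter> U)" "open_value (V \<inter> U)"]
        unfolding add.commute[of "outer_value (A \<inter> U)"] by (meson order_trans)
    qed
  qed
  then show ?thesis
    using openin_subset[OF U] by (auto simp: lambda_system_eq)
qed

definition extension :: "'a measure" where
  "extension = measure_of (topspace X) {U. openin X U} outer_value"

lemma sets_extension: "sets extension = sigma_sets (topspace X) {U. openin X U}"
  unfolding extension_def by (rule sets_measure_of) (auto dest: openin_subset)

lemma space_extension: "space extension = topspace X"
  unfolding extension_def by (rule space_measure_of) (auto dest: openin_subset)

text \<open>\<open>measure_of\<close> takes the values of \<open>outer_value\<close> only once these
  are known to form a measure on the Borel sets. By Caratheodory's lemma they do so on the lambda
  system, a sigma algebra that contains the open sets and therefore the Borel sets.\<close>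

lemma emeasure_extension:
  assumes "A \<in> sets extension"
  shows "emeasure extension A = outer_value A"
proof -
  let ?L = "lambda_system (topspace X) (Pow (topspace X)) outer_value"
  have L: "measure_space (topspace X) ?L outer_value"
    by (rule sigma_algebra.caratheodory_lemma[OF sigma_algebra_Pow outer_measure_space_outer_value])
  then interpret L: sigma_algebra "topspace X" ?L
    by (simp add: measure_space_def)
  have "sigma_sets (topspace X) {U. openin X U} \<subseteq> ?L"
    using open_in_lambda_system by (intro L.sigma_sets_subset) auto
  then have "measure_space (topspace X) (sigma_sets (topspace X) {U. openin X U}) outer_value"
    by (intro measure_down[OF L] sigma_algebra_sigma_sets) (auto dest: openin_subset)
  then show ?thesis
    using assms unfolding sets_extension
    by (intro emeasure_measure_of[OF extension_def]) 
       (auto simp: measure_space_def sets_extension dest: openin_subset)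
qed

lemma emeasure_extension_open: "openin X U \<Longrightarrow> emeasure extension U = open_value U"
  using emeasure_extension[of U] by (auto simp: sets_extension outer_value_open)

lemma emeasure_extension_compact_open:
  "openin X C \<Longrightarrow> compactin X C \<Longrightarrow> emeasure extension C = ennreal (\<mu> C)"
  using emeasure_extension_open open_value_compact_open by (simp add: compact_opens_def)

text \<open>Outer regularity is the definition of \<open>outer_value\<close>, and inner regularity
  holds because compact open sets are among the compact sets. A compact set has finite measure
  because it lies in a compact open set, where \<open>\<mu>\<close> takes a real value.\<close>

lemma radon_measure_extension: "radon_measure X extension"
  unfolding radon_measure_def
proof (intro conjI allI ballI impI)
  show "space extension = topspace X" "sets extension = sigma_sets (topspace X) {U. openin X U}"
    by (rule space_extension sets_extension)+
next
  fix K assume K: "compactin X K"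
  obtain C where C: "C \<in> compact_opens" "K \<subseteq> C" "C \<subseteq> topspace X"
    by (rule compact_open_cover[OF K openin_topspace compactin_subset_topspace[OF K]])
  have "emeasure extension K \<le> emeasure extension C"
    using C by (intro emeasure_mono) (auto simp: sets_extension compact_opens_def)
  also have "\<dots> < \<infinity>"
    using C emeasure_extension_compact_open[of C] by (simp add: compact_opens_def)
  finally show "emeasure extension K < \<infinity>" .
next
  fix A assume "A \<in> sets extension"
  then show "emeasure extension A = (INF U\<in>{U. openin X U \<and> A \<subseteq> U}. emeasure extension U)"
    by (simp add: emeasure_extension outer_value_def emeasure_extension_open)
next
  fix U assume U: "openin X U"
  show "emeasure extension U = (SUP K\<in>{K. compactin X K \<and> K \<subseteq> U}. emeasure extension K)"
  proof (rule antisym)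
    have "open_value U \<le> (SUP K\<in>{K. compactin X K \<and> K \<subseteq> U}. emeasure extension K)"
      unfolding open_value_def
      by (rule SUP_mono) (auto simp: compact_opens_def emeasure_extension_compact_open intro!: exI)
    then show "emeasure extension U \<le> (SUP K\<in>{K. compactin X K \<and> K \<subseteq> U}. emeasure extension K)"
      by (simp add: emeasure_extension_open U)
    show "(SUP K\<in>{K. compactin X K \<and> K \<subseteq> U}. emeasure extension K) \<le> emeasure extension U"
      using U by (intro SUP_least emeasure_mono) (auto simp: sets_extension)
  qed
qed

end


section \<open>Algebra and topology of etale groupoids\<close>

context groupoid
begin

lemma dom_closed: "\<gamma> \<in> arrows G \<Longrightarrow> dom_map G \<gamma> \<in> arrows G"
  unfolding dom_map_def by (intro mult_closed inv_compos)

lemma dom_inv: "\<gamma> \<in> arrows G \<Longrightarrow> dom_map G (ginv G \<gamma>) = ran_map G \<gamma>"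
  by (simp add: dom_map_def ran_map_def inv_inv)

lemma ran_inv: "\<gamma> \<in> arrows G \<Longrightarrow> ran_map G (ginv G \<gamma>) = dom_map G \<gamma>"
  by (simp add: dom_map_def ran_map_def inv_inv)

lemma dom_in_units: "\<gamma> \<in> arrows G \<Longrightarrow> dom_map G \<gamma> \<in> units G"
  by (simp add: units_def)

lemma ran_in_units: "\<gamma> \<in> arrows G \<Longrightarrow> ran_map G \<gamma> \<in> units G"
  using dom_in_units[OF inv_closed] dom_inv by simp

lemma units_subset_arrows: "units G \<subseteq> arrows G"
  using dom_closed by (auto simp: units_def)

lemma composable_arrows: "(\<alpha>, \<beta>) \<in> compos G \<Longrightarrow> \<alpha> \<in> arrows G \<and> \<beta> \<in> arrows G"
  using compos_subset by blast

lemma dom_map_mult: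
  assumes ab: "(\<alpha>, \<beta>) \<in> compos G"
  shows "dom_map G (mult G \<alpha> \<beta>) = dom_map G \<beta>"
proof -
  have b: "\<beta> \<in> arrows G"
    using ab composable_arrows by blast
  have "(mult G \<alpha> \<beta>, ginv G \<beta>) \<in> compos G"
    using assoc_compos[OF ab inv_compos'[OF b]] by blast
  then have "dom_map G (mult G \<alpha> \<beta>) = ran_map G (ginv G \<beta>)"
    by (rule composable_iff[THEN iffD1, rotated 2]) (use ab b mult_closed inv_closed in auto)
  then show ?thesis
    by (simp add: ran_inv b)
qed

lemma ran_unit:
  assumes "x \<in> units G"
  shows "ran_map G x = x"
proof -
  obtain \<gamma> where \<gamma>: "\<gamma> \<in> arrows G" "x = dom_map G \<gamma>"
    using assms by (auto simp: units_def)
  show ?thesis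
    using ran_map_mult[OF inv_compos[OF \<gamma>(1)], folded dom_map_def] ran_inv[OF \<gamma>(1)] \<gamma>(2) by simp
qed

lemma dom_unit:
  assumes "x \<in> units G"
  shows "dom_map G x = x"
proof -
  obtain \<gamma> where \<gamma>: "\<gamma> \<in> arrows G" "x = dom_map G \<gamma>"
    using assms by (auto simp: units_def)
  show ?thesis
    using dom_map_mult[OF inv_compos[OF \<gamma>(1)], folded dom_map_def] \<gamma>(2) by simp
qed

lemma inv_unit:
  assumes "x \<in> units G"
  shows "ginv G x = x"
proof -
  have x: "x \<in> arrows G"
    using assms units_subset_arrows by blast
  have "mult G (mult G (ginv G x) x) (ginv G x) = ginv G x"
    by (rule cancel_right[OF inv_compos[OF x]])
  then show ?thesis
    using dom_unit[OF assms] ran_unit[OF assms] by (simp add: dom_map_def ran_map_def)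
qed

text \<open>If the inverse of \<open>\<alpha>\<close> is composable with \<open>\<beta>\<close>,
  then \<open>\<alpha>\<close> and \<open>\<beta>\<close> have the same range and so coincide within
  \<open>U\<close>. Invariance of a mean or a measure thereby becomes a comparison of the domain
  image and the range image of a bisection.\<close>

lemma set_mult_inv_left:
  assumes "U \<subseteq> arrows G" "inj_on (ran_map G) U"
  shows "set_mult G (set_inv G U) U = dom_map G ` U"
proof -
  have "mult G (ginv G \<alpha>) \<beta> \<in> dom_map G ` U"
    if "\<alpha> \<in> U" "\<beta> \<in> U" "(ginv G \<alpha>, \<beta>) \<in> compos G" for \<alpha> \<beta>
  proof -
    have "\<alpha> = \<beta>"
      using that assms composable_iff[of "ginv G \<alpha>" \<beta>] inv_closed dom_inv
      by (metis inj_onD subsetD)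
    then show ?thesis
      using that by (auto simp: dom_map_def)
  qed
  then show ?thesis
    using assms(1) inv_compos by (fastforce simp: set_mult_def set_inv_def dom_map_def)
qed

lemma set_inv_subset: "U \<subseteq> arrows G \<Longrightarrow> set_inv G U \<subseteq> arrows G"
  using inv_closed by (auto simp: set_inv_def)

lemma set_inv_set_inv: "U \<subseteq> arrows G \<Longrightarrow> set_inv G (set_inv G U) = U"
  using inv_inv by (force simp: set_inv_def image_iff)

lemma mem_set_inv: "U \<subseteq> arrows G \<Longrightarrow> \<gamma> \<in> arrows G \<Longrightarrow> \<gamma> \<in> set_inv G U \<longleftrightarrow> ginv G \<gamma> \<in> U"
  using inv_inv by (force simp: set_inv_def image_iff)

lemma ran_set_inv: "U \<subseteq> arrows G \<Longrightarrow> ran_map G ` set_inv G U = dom_map G ` U"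
  unfolding set_inv_def image_image by (intro image_cong) (auto simp: ran_inv)

lemma dom_set_inv: "U \<subseteq> arrows G \<Longrightarrow> dom_map G ` set_inv G U = ran_map G ` U"
  unfolding set_inv_def image_image by (intro image_cong) (auto simp: dom_inv)

lemma inj_ran_set_inv:
  "U \<subseteq> arrows G \<Longrightarrow> inj_on (ran_map G) (set_inv G U) \<longleftrightarrow> inj_on (dom_map G) U"
  unfolding set_inv_def inj_on_def by (simp add: subset_iff ran_inv) (metis inv_inv)

lemma inj_dom_set_inv:
  "U \<subseteq> arrows G \<Longrightarrow> inj_on (dom_map G) (set_inv G U) \<longleftrightarrow> inj_on (ran_map G) U"
  unfolding set_inv_def inj_on_def by (simp add: subset_iff dom_inv) (metis inv_inv)

lemma set_mult_inv_right:
  assumes "U \<subseteq> arrows G" "inj_on (dom_map G) U"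
  shows "set_mult G U (set_inv G U) = ran_map G ` U"
  using set_mult_inv_left[OF set_inv_subset[OF assms(1)]] assms
  by (simp add: set_inv_set_inv inj_ran_set_inv dom_set_inv)

text \<open>An arrow has at most one factorisation with first factor in \<open>U\<close>: the
  product and its first factor have the same range, which determines the first factor, and
  cancellation determines the second.\<close>

lemma convolution_indicator:
  assumes "inj_on (ran_map G) U"
  shows "convolution G (indicator U) (indicator V) = indicator (set_mult G U V)"
proof
  fix \<gamma>
  let ?S = "{(\<alpha>, \<beta>) \<in> compos G. mult G \<alpha> \<beta> = \<gamma> \<and> indicator U \<alpha> * indicator V \<beta> \<noteq> (0::complex)}"
  have S: "?S = {(\<alpha>, \<beta>) \<in> compos G. mult G \<alpha> \<beta> = \<gamma> \<and> \<alpha> \<in> U \<and> \<beta> \<in> V}"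
    by (auto simp: indicator_def)
  show "convolution G (indicator U) (indicator V) \<gamma> = indicator (set_mult G U V) \<gamma>"
  proof (cases "\<gamma> \<in> set_mult G U V")
    case True
    then obtain \<alpha> \<beta> where ab: "\<alpha> \<in> U" "\<beta> \<in> V" "(\<alpha>, \<beta>) \<in> compos G" "\<gamma> = mult G \<alpha> \<beta>"
      by (auto simp: set_mult_def)
    have "\<alpha>' = \<alpha> \<and> \<beta>' = \<beta>"
      if "(\<alpha>', \<beta>') \<in> compos G" "mult G \<alpha>' \<beta>' = \<gamma>" "\<alpha>' \<in> U" for \<alpha>' \<beta>'
    proof -
      have "\<alpha>' = \<alpha>"
        using ran_map_mult[OF that(1)] ran_map_mult[OF ab(3)] that(2) ab(4)
        by (intro inj_onD[OF assms _ that(3) ab(1)]) simp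
      then show ?thesis
        using cancel_left[OF that(1)] cancel_left[OF ab(3)] that(2) ab(4) by metis
    qed
    then have "?S = {(\<alpha>, \<beta>)}"
      unfolding S using ab(1-3) ab(4)[symmetric] by blast
    then show ?thesis
      using True ab by (simp add: convolution_def)
  next
    case False
    then have "?S = {}"
      unfolding S by (auto simp: set_mult_def)
    then show ?thesis
      using False by (simp only: convolution_def sum.empty) simp
  qed
qed

lemma involution_indicator:
  "U \<subseteq> arrows G \<Longrightarrow> involution G (indicator U) = indicator (set_inv G U)"
  using mem_set_inv[of U] set_inv_subset[of U] by (auto simp: involution_def indicator_def fun_eq_iff)

text \<open>The factorisations of a unit \<open>x\<close> are exactly the pairs of an arrow with
  range \<open>x\<close> and its inverse.\<close>

lemma convolution_at_unit:
  assumes x: "x \<in> units G"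
  shows "convolution G f g x =
    (\<Sum>\<alpha>\<in>{\<alpha> \<in> arrows G. ran_map G \<alpha> = x \<and> f \<alpha> * g (ginv G \<alpha>) \<noteq> 0}. f \<alpha> * g (ginv G \<alpha>))"
proof -
  let ?S = "{(\<alpha>, \<beta>) \<in> compos G. mult G \<alpha> \<beta> = x \<and> f \<alpha> * g \<beta> \<noteq> 0}"
  let ?A = "{\<alpha> \<in> arrows G. ran_map G \<alpha> = x \<and> f \<alpha> * g (ginv G \<alpha>) \<noteq> 0}"
  have factor: "\<beta> = ginv G \<alpha> \<and> ran_map G \<alpha> = x" if "(\<alpha>, \<beta>) \<in> compos G" "mult G \<alpha> \<beta> = x" for \<alpha> \<beta>
  proof -
    have a: "\<alpha> \<in> arrows G"
      using that composable_arrows by blast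
    have r: "ran_map G \<alpha> = x"
      using ran_map_mult[OF that(1)] that(2) ran_unit[OF x] by simp
    then have "mult G (ginv G \<alpha>) (mult G \<alpha> \<beta>) = mult G (ginv G \<alpha>) (mult G \<alpha> (ginv G \<alpha>))"
      using that(2) by (simp add: ran_map_def)
    then show ?thesis
      using cancel_left[OF that(1)] cancel_left[OF inv_compos'[OF a]] r by simp
  qed
  have "bij_betw (\<lambda>\<alpha>. (\<alpha>, ginv G \<alpha>)) ?A ?S"
    unfolding bij_betw_def
  proof
    show "inj_on (\<lambda>\<alpha>. (\<alpha>, ginv G \<alpha>)) ?A"
      by (auto simp: inj_on_def)
    show "(\<lambda>\<alpha>. (\<alpha>, ginv G \<alpha>)) ` ?A = ?S"
    proof (intro equalityI subsetI)
      fix p assume "p \<in> (\<lambda>\<alpha>. (\<alpha>, ginv G \<alpha>)) ` ?A"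
      then obtain \<alpha> where "p = (\<alpha>, ginv G \<alpha>)" "\<alpha> \<in> ?A"
        by blast
      then show "p \<in> ?S"
        using inv_compos' by (simp add: ran_map_def)
    next
      fix p assume "p \<in> ?S"
      then obtain \<alpha> \<beta> where p: "p = (\<alpha>, \<beta>)" "(\<alpha>, \<beta>) \<in> compos G" "mult G \<alpha> \<beta> = x"
        "f \<alpha> * g \<beta> \<noteq> 0"
        by blast
      then have "\<alpha> \<in> ?A" "p = (\<alpha>, ginv G \<alpha>)"
        using factor[OF p(2,3)] composable_arrows[OF p(2)] by auto
      then show "p \<in> (\<lambda>\<alpha>. (\<alpha>, ginv G \<alpha>)) ` ?A"
        by blast
    qed
  qed
  from sum.reindex_bij_betw[OF this, of "\<lambda>(\<alpha>, \<beta>). f \<alpha> * g \<beta>"] show ?thesis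
    by (simp add: convolution_def)
qed

end

section \<open>Topology: local homeomorphisms, the open unit space, lifting along bisections\<close>

lemma local_homeomorphism_imp_open_map:
  assumes "local_homeomorphism_map X Y f"
  shows "open_map X Y f"
  unfolding open_map_def
proof (intro allI impI)
  fix V assume V: "openin X V"
  show "openin Y (f ` V)"
  proof (subst openin_subopen, clarify)
    fix x assume x: "x \<in> V"
    then have "x \<in> topspace X"
      using V openin_subset by blast
    then obtain U where U: "openin X U" "x \<in> U" "openin Y (f ` U)"
      "homeomorphic_map (subtopology X U) (subtopology Y (f ` U)) f"
      using assms unfolding local_homeomorphism_map_def by blast
    have "openin (subtopology X U) (V \<inter> U)"
      using U V by (simp add: openin_open_subtopology openin_Int)
    then have "openin (subtopology Y (f ` U)) (f ` (V \<inter> U))"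
      using homeomorphic_imp_open_map[OF U(4)] by (simp add: open_map_def)
    then have "openin Y (f ` (V \<inter> U))"
      using U(3) openin_trans_full by blast
    then show "\<exists>T. openin Y T \<and> f x \<in> T \<and> T \<subseteq> f ` V"
      using U x by (intro exI[of _ "f ` (V \<inter> U)"]) auto
  qed
qed

lemma local_homeomorphism_imp_continuous_map:
  assumes "local_homeomorphism_map X Y f"
  shows "continuous_map X Y f"
  unfolding continuous_map_def
proof (intro conjI allI impI)
  show "f \<in> topspace X \<rightarrow> topspace Y"
    using assms by (simp add: local_homeomorphism_map_def)
  fix W assume W: "openin Y W"
  show "openin X {x \<in> topspace X. f x \<in> W}"
  proof (subst openin_subopen, clarify)
    fix x assume x: "x \<in> topspace X" "f x \<in> W"
    then obtain U where U: "openin X U" "x \<in> U" "openin Y (f ` U)"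
      "homeomorphic_map (subtopology X U) (subtopology Y (f ` U)) f"
      using assms unfolding local_homeomorphism_map_def by blast
    have "openin (subtopology Y (f ` U)) (W \<inter> f ` U)"
      using U W by (simp add: openin_open_subtopology openin_Int)
    then have "openin (subtopology X U) {y \<in> topspace (subtopology X U). f y \<in> W \<inter> f ` U}"
      using homeomorphic_imp_continuous_map[OF U(4)] openin_continuous_map_preimage by blast
    then have "openin X {y \<in> topspace (subtopology X U). f y \<in> W \<inter> f ` U}"
      using U(1) openin_trans_full by blast
    then show "\<exists>T. openin X T \<and> x \<in> T \<and> T \<subseteq> {x \<in> topspace X. f x \<in> W}"
      using U x by (intro exI[of _ "{y \<in> topspace (subtopology X U). f y \<in> W \<inter> f ` U}"]) auto
  qed
qed

context etale_groupoid
begin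

lemma topspace_unit_space: "topspace (unit_space G) = units G"
  using units_subset_arrows by (auto simp: unit_space_def arrows_def)

lemma open_dom: "open_map (topol G) (unit_space G) (dom_map G)"
  by (rule local_homeomorphism_imp_open_map[OF dom_local_homeo])

lemma continuous_dom: "continuous_map (topol G) (unit_space G) (dom_map G)"
  by (rule local_homeomorphism_imp_continuous_map[OF dom_local_homeo])

text \<open>If \<open>dom_map G\<close> is injective on a neighbourhood \<open>U\<close> of a unit, then every \<open>y \<in> U\<close> whose
  domain lies in \<open>U\<close> equals its domain.\<close>

lemma openin_units: "openin (topol G) (units G)"
proof (subst openin_subopen, intro ballI)
  fix x assume x: "x \<in> units G"
  then have "x \<in> topspace (topol G)"
    using units_subset_arrows by (auto simp: arrows_def)
  then obtain U where U: "openin (topol G) U" "x \<in> U"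
    "homeomorphic_map (subtopology (topol G) U) (subtopology (unit_space G) (dom_map G ` U)) (dom_map G)"
    using dom_local_homeo unfolding local_homeomorphism_map_def by blast
  have sub: "U \<subseteq> arrows G"
    using U(1) openin_subset by (simp add: arrows_def)
  have inj: "inj_on (dom_map G) U"
    using homeomorphic_imp_injective_map[OF U(3)] sub by (simp add: arrows_def inf.absorb2)
  have "continuous_map (topol G) (topol G) (dom_map G)"
    using continuous_dom unfolding unit_space_def by (rule continuous_map_into_fulltopology)
  then have "openin (topol G) (U \<inter> {y \<in> topspace (topol G). dom_map G y \<in> U})"
    using U(1) openin_continuous_map_preimage by blast
  moreover have "U \<inter> {y \<in> topspace (topol G). dom_map G y \<in> U} \<subseteq> units G"
  proof
    fix y assume y: "y \<in> U \<inter> {y \<in> topspace (topol G). dom_map G y \<in> U}"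
    have unit: "dom_map G y \<in> units G"
      using y sub dom_in_units by blast
    have "dom_map G y = y"
      using y by (intro inj_onD[OF inj dom_unit[OF unit]]) auto
    then show "y \<in> units G"
      using unit by simp
  qed
  ultimately show "\<exists>T. openin (topol G) T \<and> x \<in> T \<and> T \<subseteq> units G"
    using U(2) x dom_unit units_subset_arrows
    by (intro exI[of _ "U \<inter> {y \<in> topspace (topol G). dom_map G y \<in> U}"]) (auto simp: arrows_def)
qed

lemma openin_unit_space: "openin (unit_space G) U \<longleftrightarrow> openin (topol G) U \<and> U \<subseteq> units G"
  unfolding unit_space_def by (rule openin_open_subtopology[OF openin_units])

lemma compactin_unit_space: "compactin (unit_space G) K \<longleftrightarrow> compactin (topol G) K \<and> K \<subseteq> units G"
  by (simp add: unit_space_def compactin_subtopology)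

lemma openin_arrows: "openin (topol G) U \<Longrightarrow> U \<subseteq> arrows G"
  by (simp add: arrows_def openin_subset)

lemma openin_set_inv:
  assumes "openin (topol G) U"
  shows "openin (topol G) (set_inv G U)"
proof -
  have "set_inv G U = {\<gamma> \<in> topspace (topol G). ginv G \<gamma> \<in> U}"
    using mem_set_inv[OF openin_arrows[OF assms]] set_inv_subset[OF openin_arrows[OF assms]]
    by (auto simp: arrows_def)
  then show ?thesis
    using openin_continuous_map_preimage[OF continuous_inv assms] by simp
qed

lemma openin_ran:
  assumes "openin (topol G) U"
  shows "openin (unit_space G) (ran_map G ` U)"
  using open_dom openin_set_inv[OF assms] dom_set_inv[OF openin_arrows[OF assms]]
  by (metis open_map_def)

lemma openin_dom: "openin (topol G) U \<Longrightarrow> openin (unit_space G) (dom_map G ` U)"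
  using open_dom by (simp add: open_map_def)

lemma compactin_set_inv: "compactin (topol G) U \<Longrightarrow> compactin (topol G) (set_inv G U)"
  unfolding set_inv_def by (rule image_compactin[OF _ continuous_inv])

lemma compactin_dom: "compactin (topol G) U \<Longrightarrow> compactin (unit_space G) (dom_map G ` U)"
  by (rule image_compactin[OF _ continuous_dom])

lemma compactin_ran:
  assumes "compactin (topol G) U"
  shows "compactin (unit_space G) (ran_map G ` U)"
  using compactin_dom[OF compactin_set_inv[OF assms]] dom_set_inv[of U] 
    compactin_subset_topspace[OF assms] by (simp add: arrows_def)

lemma set_inv_open_bisection: "U \<in> open_bisections G \<Longrightarrow> set_inv G U \<in> open_bisections G"
  using openin_set_inv openin_arrows inj_ran_set_inv inj_dom_set_inv
  by (auto simp: open_bisections_def)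

lemma set_inv_bisection: "U \<in> compact_bisections G \<Longrightarrow> set_inv G U \<in> compact_bisections G"
  using set_inv_open_bisection compactin_set_inv by (simp add: compact_bisections_def)

lemma open_bisection_subset:
  assumes "U \<in> open_bisections G" "openin (topol G) V" "V \<subseteq> U"
  shows "V \<in> open_bisections G"
  using assms inj_on_subset unfolding open_bisections_def by blast

lemma bisection_arrows: "U \<in> compact_bisections G \<Longrightarrow> U \<subseteq> arrows G"
  by (simp add: compact_bisections_def open_bisections_def openin_arrows)

lemma compact_open_units_bisection:
  assumes "U \<in> compact_open_units G"
  shows "U \<in> compact_bisections G" "U \<subseteq> units G"
proof -
  show U: "U \<subseteq> units G"
    using assms by (simp add: compact_open_units_def openin_unit_space)
  have "inj_on (dom_map G) U" "inj_on (ran_map G) U"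
    using U dom_unit ran_unit by (auto simp: inj_on_def subset_iff)
  then show "U \<in> compact_bisections G"
    using assms
    by (simp add: compact_open_units_def compact_bisections_def open_bisections_def
        openin_unit_space compactin_unit_space)
qed

text \<open>On an open bisection the domain map is injective, continuous and open, hence a
  homeomorphism onto its open image, and the part of \<open>U\<close> over \<open>C\<close> inherits
  compactness from \<open>C\<close>. Invariance on open bisections is reduced to invariance on
  compact ones in this way.\<close>

lemma compact_open_lift:
  assumes U: "U \<in> open_bisections G"
    and C: "openin (unit_space G) C" "compactin (unit_space G) C" "C \<subseteq> dom_map G ` U"
  obtains W where "W \<in> compact_bisections G" "W \<subseteq> U" "dom_map G ` W = C"
proof -
  have oU: "openin (topol G) U" and inj: "inj_on (dom_map G) U"
    using U by (simp_all add: open_bisections_def)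
  let ?X = "subtopology (topol G) U" and ?Y = "subtopology (unit_space G) (dom_map G ` U)"
  have top: "topspace ?X = U" "topspace ?Y = dom_map G ` U"
    using openin_subset[OF oU] openin_subset[OF openin_dom[OF oU]] by auto
  have hom: "homeomorphic_map ?X ?Y (dom_map G)"
  proof (rule bijective_open_imp_homeomorphic_map)
    show "continuous_map ?X ?Y (dom_map G)"
      using continuous_dom by (intro continuous_map_into_subtopology continuous_map_from_subtopology) auto
    show "open_map ?X ?Y (dom_map G)"
      using openin_dom oU openin_dom[OF oU]
      by (auto simp: open_map_def openin_open_subtopology)
  qed (use top inj in auto)
  let ?W = "U \<inter> {\<gamma> \<in> topspace (topol G). dom_map G \<gamma> \<in> C}"
  have W: "openin (topol G) ?W"
    using oU openin_continuous_map_preimage[OF continuous_dom C(1)] by blast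
  have dW: "dom_map G ` ?W = C"
    using C(3) openin_subset[OF oU] by auto
  have "compactin ?Y (dom_map G ` ?W)"
    unfolding dW using C by (simp add: compactin_subtopology)
  then have "compactin ?X ?W"
    using homeomorphic_map_compactness[OF hom, of ?W] top by auto
  then have "compactin (topol G) ?W"
    by (simp add: compactin_subtopology)
  then have "?W \<in> compact_bisections G"
    using open_bisection_subset[OF U W] by (simp add: compact_bisections_def)
  then show ?thesis
    using that dW by blast
qed

end


section \<open>Convolution on the unit space\<close>

lemma sum_fun_apply: "(\<Sum>a\<in>A. h a) x = (\<Sum>a\<in>A. h a x)"
  for h :: "'b \<Rightarrow> 'a \<Rightarrow> 'c::comm_monoid_add"
  by (induction A rule: infinite_finite_induct) auto

lemma groupoid_algebra_indicator: "U \<in> compact_bisections G \<Longrightarrow> indicator U \<in> groupoid_algebra G"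
  unfolding groupoid_algebra_def by (intro complex_fun.span_base imageI)

text \<open>Elements of the span come as sums over indicator functions. Selecting one bisection for
  each such function gives a sum over bisections, the form in which convolutions and integrals are
  computed.\<close>

lemma groupoid_algebra_representation:
  assumes "f \<in> groupoid_algebra G"
  obtains S c where "finite S" "S \<subseteq> compact_bisections G" "f = (\<lambda>\<gamma>. \<Sum>U\<in>S. c U * indicator U \<gamma>)"
proof -
  obtain t r where t: "finite t" "t \<subseteq> indicator ` compact_bisections G"
    and f: "f = (\<Sum>a\<in>t. fun_scale (r a) a)"
    using assms unfolding groupoid_algebra_def complex_fun.span_explicit by blast
  obtain S where S: "S \<subseteq> compact_bisections G"
    "inj_on (indicator :: 'a set \<Rightarrow> 'a \<Rightarrow> complex) S" "t = indicator ` S"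
    using t(2) unfolding subset_image_inj by blast
  have rep: "f = (\<lambda>\<gamma>. \<Sum>U\<in>S. r (indicator U) * indicator U \<gamma>)"
    unfolding f S(3) by (subst sum.reindex[OF S(2)]) (simp add: fun_eq_iff sum_fun_apply fun_scale_def)
  have fin: "finite S"
    using t(1) S(3) finite_image_iff[OF S(2)] by simp
  show ?thesis
    by (rule that[OF fin S(1) rep])
qed

lemma groupoid_algebra_sum_indicator:
  assumes "\<And>i. i \<in> I \<Longrightarrow> W i \<in> compact_bisections G"
  shows "(\<lambda>\<gamma>. \<Sum>i\<in>I. c i * indicator (W i) \<gamma>) \<in> groupoid_algebra G"
proof -
  have "(\<lambda>\<gamma>. \<Sum>i\<in>I. c i * indicator (W i) \<gamma>) = (\<Sum>i\<in>I. fun_scale (c i) (indicator (W i)))"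
    by (simp add: fun_eq_iff sum_fun_apply fun_scale_def)
  then show ?thesis
    unfolding groupoid_algebra_def using assms
    by (simp add: complex_fun.span_sum complex_fun.span_scale complex_fun.span_base)
qed

section \<open>Fibres of the range map and the fibre energy\<close>

definition fiber :: "'a tgroupoid \<Rightarrow> ('a \<Rightarrow> complex) \<Rightarrow> 'a \<Rightarrow> 'a set" where
  "fiber G f x = {\<alpha> \<in> arrows G. ran_map G \<alpha> = x \<and> f \<alpha> \<noteq> 0}"

text \<open>This is the squared l2 norm of \<open>f\<close> on the arrows with range
  \<open>x\<close>. Zeros of \<open>f\<close> are left out of \<open>fiber\<close> because
  \<open>sum\<close> over an infinite set is 0, whereas for members of the algebra the remaining
  index set is finite.\<close>

definition fiber_energy :: "'a tgroupoid \<Rightarrow> ('a \<Rightarrow> complex) \<Rightarrow> 'a \<Rightarrow> real" where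
  "fiber_energy G f x = (\<Sum>\<alpha>\<in>fiber G f x. (norm (f \<alpha>))\<^sup>2)"

lemma finite_bisection_fiber:
  assumes "U \<in> compact_bisections G"
  shows "finite {\<alpha> \<in> U. ran_map G \<alpha> = x}"
proof (rule inj_on_finite)
  show "inj_on (ran_map G) {\<alpha> \<in> U. ran_map G \<alpha> = x}"
    using assms by (auto simp: compact_bisections_def open_bisections_def inj_on_def)
  show "ran_map G ` {\<alpha> \<in> U. ran_map G \<alpha> = x} \<subseteq> {x}"
    by auto
qed simp

lemma finite_fiber:
  assumes "f \<in> groupoid_algebra G"
  shows "finite (fiber G f x)"
proof -
  obtain \<U> where U: "finite \<U>" "\<U> \<subseteq> compact_bisections G" "\<And>\<gamma>. f \<gamma> \<noteq> 0 \<Longrightarrow> \<exists>U\<in>\<U>. \<gamma> \<in> U"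
    using groupoid_algebra_finite_cover[OF assms] by metis
  have "fiber G f x \<subseteq> (\<Union>U\<in>\<U>. {\<alpha> \<in> U. ran_map G \<alpha> = x})"
    using U(3) by (fastforce simp: fiber_def)
  moreover have "finite (\<Union>U\<in>\<U>. {\<alpha> \<in> U. ran_map G \<alpha> = x})"
    using U(1,2) by (intro finite_UN_I finite_bisection_fiber) auto
  ultimately show ?thesis
    by (rule finite_subset)
qed

lemma fiber_energy_nonneg: "0 \<le> fiber_energy G f x"
  by (simp add: fiber_energy_def sum_nonneg)

lemma fiber_energy_eq_0_iff:
  assumes "f \<in> groupoid_algebra G"
  shows "fiber_energy G f x = 0 \<longleftrightarrow> fiber G f x = {}"
proof
  assume "fiber_energy G f x = 0"
  then have "\<forall>\<alpha>\<in>fiber G f x. (norm (f \<alpha>))\<^sup>2 = 0"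
    unfolding fiber_energy_def by (subst (asm) sum_nonneg_eq_0_iff) (auto intro: finite_fiber[OF assms])
  then show "fiber G f x = {}"
    by (auto simp: fiber_def)
qed (simp add: fiber_energy_def)

text \<open>Injectivity leaves at most one element of \<open>W\<close> above \<open>x\<close>. The
  set \<open>A\<close> may exceed the fibre of \<open>W\<close>, so that a single finite set serves
  for several \<open>W\<close> at once.\<close>

lemma sum_indicator_fiber:
  assumes "inj_on r W" "finite A" "{\<alpha> \<in> W. r \<alpha> = x} \<subseteq> A" "A \<subseteq> {\<alpha>. r \<alpha> = x}"
  shows "(\<Sum>\<alpha>\<in>A. indicator W \<alpha>) = (indicator (r ` W) x :: complex)"
proof (cases "x \<in> r ` W")
  case True
  then obtain \<alpha> where a: "\<alpha> \<in> W" "x = r \<alpha>"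
    by blast
  have A: "\<alpha> \<in> A"
    using a assms(3) by blast
  have "\<beta> \<notin> W" if "\<beta> \<in> A - {\<alpha>}" for \<beta>
    using that inj_onD[OF assms(1) _ _ a(1), of \<beta>] a(2) assms(4) by blast
  then have "(\<Sum>\<beta>\<in>A - {\<alpha>}. indicator W \<beta>) = (0::complex)"
    by (intro sum.neutral ballI) simp
  then show ?thesis
    using True a(1) A assms(2) by (simp add: sum.remove[of A \<alpha>])
next
  case False
  then have "(\<Sum>\<alpha>\<in>A. indicator W \<alpha>) = (0::complex)"
    using assms(4) by (intro sum.neutral) (auto simp: indicator_def)
  then show ?thesis
    using False by simp
qed

context groupoid
begin

text \<open>At the inverse of \<open>\<alpha>\<close> the involution of \<open>f\<close> has the
  value \<open>cnj (f \<alpha>)\<close>, so each term in \<open>convolution_at_unit\<close> is a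
  squared modulus.\<close>

lemma convolution_star_at_unit:
  assumes "x \<in> units G"
  shows "convolution G f (involution G f) x = complex_of_real (fiber_energy G f x)"
proof -
  have "involution G f (ginv G \<alpha>) = cnj (f \<alpha>)" if "\<alpha> \<in> arrows G" for \<alpha>
    using that by (simp add: involution_def inv_closed inv_inv)
  then have "{\<alpha> \<in> arrows G. ran_map G \<alpha> = x \<and> f \<alpha> * involution G f (ginv G \<alpha>) \<noteq> 0} = fiber G f x"
    and "\<alpha> \<in> fiber G f x \<Longrightarrow> f \<alpha> * involution G f (ginv G \<alpha>) = of_real ((norm (f \<alpha>))\<^sup>2)" for \<alpha>
    unfolding complex_norm_square by (auto simp: fiber_def)
  then show ?thesis
    by (simp add: convolution_at_unit[OF assms] fiber_energy_def)
qed

text \<open>\<open>(f * 1\<^sub>U)(\<gamma>)\<close> is \<open>f(\<gamma> \<beta>\<^sup>-\<^sup>1)\<close> for the unique \<open>\<beta> \<in> U\<close> with the same domain as \<open>\<gamma>\<close>, if there is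
  one, and \<open>\<gamma> \<mapsto> \<gamma> \<beta>\<^sup>-\<^sup>1\<close> is injective on each fibre of \<open>ran_map G\<close>.\<close>

lemma fiber_energy_convolution_indicator:
  assumes f: "f \<in> groupoid_algebra G" and U: "U \<in> open_bisections G"
  shows "fiber_energy G (convolution G f (indicator U)) x \<le> fiber_energy G f x"
proof -
  let ?h = "convolution G f (indicator U)"
  have inj: "inj_on (dom_map G) U" "inj_on (ran_map G) U"
    using U by (simp_all add: open_bisections_def)
  have "\<exists>\<alpha> \<beta>. (\<alpha>, \<beta>) \<in> compos G \<and> mult G \<alpha> \<beta> = \<gamma> \<and> \<beta> \<in> U \<and> ?h \<gamma> = f \<alpha>"
    if h: "?h \<gamma> \<noteq> 0" for \<gamma>
  proof -
    let ?S = "{(\<alpha>, \<beta>) \<in> compos G. mult G \<alpha> \<beta> = \<gamma> \<and> f \<alpha> * indicator U \<beta> \<noteq> 0}"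
    have "?S \<noteq> {}"
    proof
      assume "?S = {}"
      with h show False
        unfolding convolution_def by (simp only: sum.empty)
    qed
    then obtain \<alpha> \<beta> where "(\<alpha>, \<beta>) \<in> ?S"
      by (metis (no_types, lifting) ex_in_conv surj_pair)
    then have ab: "(\<alpha>, \<beta>) \<in> compos G" "mult G \<alpha> \<beta> = \<gamma>" "f \<alpha> \<noteq> 0" "\<beta> \<in> U"
      by (auto simp: indicator_def split: if_splits)
    have "\<alpha>' = \<alpha> \<and> \<beta>' = \<beta>"
      if p: "(\<alpha>', \<beta>') \<in> compos G" "mult G \<alpha>' \<beta>' = \<gamma>" "\<beta>' \<in> U" for \<alpha>' \<beta>'
    proof -
      have "\<beta>' = \<beta>"
        using dom_map_mult[OF ab(1)] dom_map_mult[OF p(1)] ab(2) p(2)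
        by (intro inj_onD[OF inj(1) _ p(3) ab(4)]) simp
      then show ?thesis
        using cancel_right[OF ab(1)] cancel_right[OF p(1)] unfolding ab(2) p(2) by simp
    qed
    moreover have "?S = {(\<alpha>, \<beta>) \<in> compos G. mult G \<alpha> \<beta> = \<gamma> \<and> f \<alpha> \<noteq> 0 \<and> \<beta> \<in> U}"
      by (auto simp: indicator_def)
    ultimately have "?S = {(\<alpha>, \<beta>)}"
      using ab by blast
    then have "?h \<gamma> = f \<alpha>"
      unfolding convolution_def using ab(4) by simp
    then show ?thesis
      using ab by blast
  qed
  then have "\<forall>\<gamma>\<in>{\<gamma>. ?h \<gamma> \<noteq> 0}. \<exists>p. p \<in> compos G \<and> mult G (fst p) (snd p) = \<gamma> \<and> snd p \<in> U \<and>
      ?h \<gamma> = f (fst p)"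
    by fastforce
  from bchoice[OF this] obtain p where p: "\<And>\<gamma>. ?h \<gamma> \<noteq> 0 \<Longrightarrow> p \<gamma> \<in> compos G \<and>
      mult G (fst (p \<gamma>)) (snd (p \<gamma>)) = \<gamma> \<and> snd (p \<gamma>) \<in> U \<and> ?h \<gamma> = f (fst (p \<gamma>))"
    by blast
  \<comment> \<open>\<open>p\<close> selects for each \<open>\<gamma>\<close> in the support of the
    convolution a factorisation with second factor in \<open>U\<close>; \<open>a\<close> and
    \<open>b\<close> are its two factors.\<close>
  define a b where "a = fst \<circ> p" and "b = snd \<circ> p"
  have ab: "(a \<gamma>, b \<gamma>) \<in> compos G" "mult G (a \<gamma>) (b \<gamma>) = \<gamma>" "b \<gamma> \<in> U" "?h \<gamma> = f (a \<gamma>)"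
    if "?h \<gamma> \<noteq> 0" for \<gamma>
    using p[OF that] by (auto simp: a_def b_def)
  have maps: "a ` fiber G ?h x \<subseteq> fiber G f x"
  proof
    fix \<alpha> assume "\<alpha> \<in> a ` fiber G ?h x"
    then obtain \<gamma> where g: "\<alpha> = a \<gamma>" "?h \<gamma> \<noteq> 0" "ran_map G \<gamma> = x"
      by (auto simp: fiber_def)
    note A = ab[OF g(2)]
    have "ran_map G (a \<gamma>) = x"
      using ran_map_mult[OF A(1)] A(2) g(3) by simp
    moreover have "f (a \<gamma>) \<noteq> 0"
      using A(4) g(2) by simp
    moreover have "a \<gamma> \<in> arrows G"
      using composable_arrows[OF A(1)] by blast
    ultimately show "\<alpha> \<in> fiber G f x"
      by (simp add: fiber_def g(1))
  qed
  \<comment> \<open>If \<open>a \<gamma>\<close> and \<open>a \<delta>\<close> agree, then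
    \<open>b \<gamma>\<close> and \<open>b \<delta>\<close> have a common range, namely the domain
    of that arrow, and the range map is injective on \<open>U\<close>.\<close>
  have inj_a: "inj_on a (fiber G ?h x)"
  proof (rule inj_onI)
    fix \<gamma> \<delta> assume gd: "\<gamma> \<in> fiber G ?h x" "\<delta> \<in> fiber G ?h x" "a \<gamma> = a \<delta>"
    have nz: "?h \<gamma> \<noteq> 0" "?h \<delta> \<noteq> 0"
      using gd(1,2) unfolding fiber_def by blast+
    note A = ab[OF nz(1)] and B = ab[OF nz(2)]
    have "ran_map G (b \<gamma>) = ran_map G (b \<delta>)"
      using composable_iff[of "a \<gamma>" "b \<gamma>"] composable_iff[of "a \<delta>" "b \<delta>"] A(1) B(1) gd(3)
        composable_arrows[OF A(1)] composable_arrows[OF B(1)] by simp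
    then have "b \<gamma> = b \<delta>"
      by (rule inj_onD[OF inj(2) _ A(3) B(3)])
    then have "mult G (a \<gamma>) (b \<gamma>) = mult G (a \<delta>) (b \<delta>)"
      by (simp only: gd(3))
    then show "\<gamma> = \<delta>"
      unfolding A(2) B(2) .
  qed
  have "fiber_energy G ?h x = (\<Sum>\<gamma>\<in>fiber G ?h x. (norm (f (a \<gamma>)))\<^sup>2)"
    unfolding fiber_energy_def
  proof (rule sum.cong[OF refl])
    fix \<gamma> assume "\<gamma> \<in> fiber G ?h x"
    then have "?h \<gamma> \<noteq> 0"
      unfolding fiber_def by blast
    from ab(4)[OF this] show "(norm (?h \<gamma>))\<^sup>2 = (norm (f (a \<gamma>)))\<^sup>2"
      by simp
  qed
  also have "\<dots> = (\<Sum>\<alpha>\<in>a ` fiber G ?h x. (norm (f \<alpha>))\<^sup>2)"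
    by (simp add: sum.reindex[OF inj_a])
  also have "\<dots> \<le> fiber_energy G f x"
    unfolding fiber_energy_def by (rule sum_mono2[OF finite_fiber[OF f] maps]) simp
  finally show ?thesis .
qed

text \<open>An arrow \<open>\<alpha>\<close> with range \<open>x\<close> contributes to the pair
  \<open>U\<close>, \<open>V\<close> exactly if it lies in \<open>U\<close> and its inverse lies in
  \<open>V\<close>. The convolution on units is thus a combination of indicators of sets of units,
  ready for integration term by term.\<close>

lemma convolution_sum_at_unit:
  assumes S: "finite S" "S \<subseteq> compact_bisections G"
    and T: "\<And>V. V \<in> T \<Longrightarrow> V \<subseteq> arrows G"
    and S_arrows: "\<And>U. U \<in> S \<Longrightarrow> U \<subseteq> arrows G"
    and f: "f = (\<lambda>\<gamma>. \<Sum>U\<in>S. c U * indicator U \<gamma>)"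
    and g: "g = (\<lambda>\<gamma>. \<Sum>V\<in>T. d V * indicator V \<gamma>)"
    and x: "x \<in> units G"
  shows "convolution G f g x =
    (\<Sum>U\<in>S. \<Sum>V\<in>T. c U * d V * indicator (ran_map G ` (U \<inter> set_inv G V)) x)"
proof -
  \<comment> \<open>A finite set of arrows with range \<open>x\<close> that contains all those where
    \<open>f\<close> does not vanish. As it is the same for all pairs \<open>U\<close>,
    \<open>V\<close>, the sums can be interchanged.\<close>
  define A where "A = (\<Union>U\<in>S. {\<alpha> \<in> U. ran_map G \<alpha> = x})"
  have finA: "finite A"
    unfolding A_def using S by (intro finite_UN_I finite_bisection_fiber) auto
  have A: "A \<subseteq> arrows G" "A \<subseteq> {\<alpha>. ran_map G \<alpha> = x}"
    using S_arrows by (auto simp: A_def)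
  have supp_A: "\<alpha> \<in> A" if "f \<alpha> \<noteq> 0" "ran_map G \<alpha> = x" for \<alpha>
  proof -
    have "(\<Sum>U\<in>S. c U * indicator U \<alpha>) \<noteq> 0"
      using that(1) unfolding f .
    then obtain U where "U \<in> S" "c U * indicator U \<alpha> \<noteq> 0"
      by (rule sum.not_neutral_contains_not_neutral)
    then show ?thesis
      using that(2) by (auto simp: A_def indicator_def split: if_splits)
  qed
  have "convolution G f g x = (\<Sum>\<alpha>\<in>A. f \<alpha> * g (ginv G \<alpha>))"
    unfolding convolution_at_unit[OF x]
  proof (rule sum.mono_neutral_left[OF finA])
    show "{\<alpha> \<in> arrows G. ran_map G \<alpha> = x \<and> f \<alpha> * g (ginv G \<alpha>) \<noteq> 0} \<subseteq> A"
      using supp_A by (simp add: subset_iff)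
    show "\<forall>\<alpha>\<in>A - {\<alpha> \<in> arrows G. ran_map G \<alpha> = x \<and> f \<alpha> * g (ginv G \<alpha>) \<noteq> 0}.
        f \<alpha> * g (ginv G \<alpha>) = 0"
      using A by blast
  qed
  also have "\<dots> = (\<Sum>\<alpha>\<in>A. \<Sum>U\<in>S. \<Sum>V\<in>T. c U * d V * indicator (U \<inter> set_inv G V) \<alpha>)"
  proof (rule sum.cong[OF refl])
    fix \<alpha> assume "\<alpha> \<in> A"
    then have "indicator V (ginv G \<alpha>) = (indicator (set_inv G V) \<alpha> :: complex)" if "V \<in> T" for V
      using mem_set_inv[OF T[OF that], of \<alpha>] A(1) by (auto simp: indicator_def)
    then have "g (ginv G \<alpha>) = (\<Sum>V\<in>T. d V * indicator (set_inv G V) \<alpha>)"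
      by (simp add: g)
    then have "f \<alpha> * g (ginv G \<alpha>) =
        (\<Sum>U\<in>S. c U * indicator U \<alpha>) * (\<Sum>V\<in>T. d V * indicator (set_inv G V) \<alpha>)"
      by (simp only: f)
    then show "f \<alpha> * g (ginv G \<alpha>) =
        (\<Sum>U\<in>S. \<Sum>V\<in>T. c U * d V * indicator (U \<inter> set_inv G V) \<alpha>)"
      by (simp only: sum_product indicator_inter_arith mult_ac)
  qed
  also have "\<dots> = (\<Sum>U\<in>S. \<Sum>\<alpha>\<in>A. \<Sum>V\<in>T. c U * d V * indicator (U \<inter> set_inv G V) \<alpha>)"
    by (rule sum.swap)
  also have "\<dots> = (\<Sum>U\<in>S. \<Sum>V\<in>T. c U * d V * (\<Sum>\<alpha>\<in>A. indicator (U \<inter> set_inv G V) \<alpha>))"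
    unfolding sum_distrib_left by (intro sum.cong refl sum.swap)
  also have "\<dots> = (\<Sum>U\<in>S. \<Sum>V\<in>T. c U * d V * indicator (ran_map G ` (U \<inter> set_inv G V)) x)"
  proof (intro sum.cong refl arg_cong2[where f = "(*)"])
    fix U V assume U: "U \<in> S"
    have "inj_on (ran_map G) U"
      using U S by (auto simp: compact_bisections_def open_bisections_def)
    then have "inj_on (ran_map G) (U \<inter> set_inv G V)"
      by (rule inj_on_subset) simp
    then show "(\<Sum>\<alpha>\<in>A. indicator (U \<inter> set_inv G V) \<alpha>) =
        (indicator (ran_map G ` (U \<inter> set_inv G V)) x :: complex)"
      by (rule sum_indicator_fiber[OF _ finA _ A(2)]) (use U in \<open>auto simp: A_def\<close>)
  qed
  finally show ?thesis .
qed

end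

lemma (in etale_groupoid) groupoid_algebra_involution:
  assumes "f \<in> groupoid_algebra G"
  shows "involution G f \<in> groupoid_algebra G"
proof -
  obtain S c where S: "S \<subseteq> compact_bisections G"
    and f: "f = (\<lambda>\<gamma>. \<Sum>U\<in>S. c U * indicator U \<gamma>)"
    by (rule groupoid_algebra_representation[OF assms])
  have "involution G f = (\<lambda>\<gamma>. \<Sum>U\<in>S. cnj (c U) * indicator (set_inv G U) \<gamma>)"
  proof
    fix \<gamma>
    have ind: "cnj (indicator U (ginv G \<gamma>)) = indicator (set_inv G U) \<gamma>"
      if "U \<in> S" "\<gamma> \<in> arrows G" for U
      using mem_set_inv[of U \<gamma>] bisection_arrows[of U] that S by (auto simp: indicator_def)
    have "indicator (set_inv G U) \<gamma> = (0 :: complex)" if "U \<in> S" "\<gamma> \<notin> arrows G" for U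
      using set_inv_subset[OF bisection_arrows[of U]] that S by (auto simp: indicator_def)
    with ind show "involution G f \<gamma> = (\<Sum>U\<in>S. cnj (c U) * indicator (set_inv G U) \<gamma>)"
      by (cases "\<gamma> \<in> arrows G") (simp_all add: involution_def f)
  qed
  then show ?thesis
    using S by (auto intro!: groupoid_algebra_sum_indicator set_inv_bisection)
qed


section \<open>Means and traces\<close>

lemma has_bochner_integral_complex_indicator:
  assumes "A \<in> sets M" "emeasure M A < \<infinity>"
  shows "has_bochner_integral M (indicator A) (complex_of_real (measure M A))"
proof -
  have "(\<lambda>x. complex_of_real (indicator A x)) = indicator A"
    by (auto simp: fun_eq_iff indicator_def)
  then show ?thesis
    using has_bochner_integral_of_real[OF has_bochner_integral_real_indicator[OF assms], where 'a = complex]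
    by simp
qed

section \<open>Integration against an invariant measure as a trace\<close>

locale invariant_measure_groupoid = etale_groupoid +
  fixes M :: "'a measure"
  assumes invariant: "invariant_measure G M"
begin

lemma space_M: "space M = units G"
  using invariant by (simp add: invariant_measure_def radon_measure_def topspace_unit_space)

lemma open_sets_M: "openin (unit_space G) U \<Longrightarrow> U \<in> sets M"
  using invariant by (auto simp: invariant_measure_def radon_measure_def)

lemma compact_finite_M: "compactin (unit_space G) K \<Longrightarrow> emeasure M K < \<infinity>"
  using invariant by (simp add: invariant_measure_def radon_measure_def)

lemma measure_dom_eq_ran:
  assumes "U \<in> open_bisections G"
  shows "measure M (dom_map G ` U) = measure M (ran_map G ` U)"
proof -
  have U: "U \<subseteq> arrows G" "inj_on (dom_map G) U" "inj_on (ran_map G) U"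
    using assms openin_arrows by (auto simp: open_bisections_def)
  have "emeasure M (set_mult G (set_inv G U) U) = emeasure M (set_mult G U (set_inv G U))"
    using invariant assms by (simp add: invariant_measure_def)
  then show ?thesis
    by (simp add: set_mult_inv_left set_mult_inv_right U measure_def)
qed

text \<open>Meant for intersections such as \<open>U \<inter> set_inv G V\<close>, which are open
  but may fail to be compact if the groupoid is not Hausdorff. Finiteness comes from the compact
  range of the larger bisection \<open>U\<close>.\<close>

lemma ran_image_finite:
  assumes U: "U \<in> compact_bisections G" and W: "openin (topol G) W" "W \<subseteq> U"
  shows "ran_map G ` W \<in> sets M" "emeasure M (ran_map G ` W) < \<infinity>"
proof -
  show "ran_map G ` W \<in> sets M"
    by (intro open_sets_M openin_ran W)
  have "openin (topol G) U" "compactin (topol G) U"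
    using U by (simp_all add: compact_bisections_def open_bisections_def)
  then have "emeasure M (ran_map G ` W) \<le> emeasure M (ran_map G ` U)"
    using W(2) by (intro emeasure_mono open_sets_M openin_ran) auto
  also have "\<dots> < \<infinity>"
    by (intro compact_finite_M compactin_ran \<open>compactin (topol G) U\<close>)
  finally show "emeasure M (ran_map G ` W) < \<infinity>" .
qed

lemma openin_inter_set_inv:
  assumes "U \<in> compact_bisections G" "V \<in> compact_bisections G"
  shows "openin (topol G) (U \<inter> set_inv G V)"
  using assms openin_set_inv by (auto simp: compact_bisections_def open_bisections_def)

lemma has_integral_convolution:
  assumes S: "finite S" "S \<subseteq> compact_bisections G" and T: "T \<subseteq> compact_bisections G"
    and f: "f = (\<lambda>\<gamma>. \<Sum>U\<in>S. c U * indicator U \<gamma>)"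
    and g: "g = (\<lambda>\<gamma>. \<Sum>V\<in>T. d V * indicator V \<gamma>)"
  shows "has_bochner_integral M (convolution G f g)
    (\<Sum>U\<in>S. \<Sum>V\<in>T. c U * d V * complex_of_real (measure M (ran_map G ` (U \<inter> set_inv G V))))"
proof -
  have "has_bochner_integral M
      (\<lambda>x. \<Sum>U\<in>S. \<Sum>V\<in>T. c U * d V * indicator (ran_map G ` (U \<inter> set_inv G V)) x)
      (\<Sum>U\<in>S. \<Sum>V\<in>T. c U * d V * complex_of_real (measure M (ran_map G ` (U \<inter> set_inv G V))))"
  proof (intro has_bochner_integral_sum has_bochner_integral_mult_right
      has_bochner_integral_complex_indicator)
    fix U V assume "U \<in> S" "V \<in> T"
    then have UV: "U \<in> compact_bisections G" "V \<in> compact_bisections G"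
      using S T by auto
    show "ran_map G ` (U \<inter> set_inv G V) \<in> sets M" "emeasure M (ran_map G ` (U \<inter> set_inv G V)) < \<infinity>"
      by (rule ran_image_finite[OF UV(1) openin_inter_set_inv[OF UV] Int_lower1])+
  qed
  moreover have "convolution G f g x =
      (\<Sum>U\<in>S. \<Sum>V\<in>T. c U * d V * indicator (ran_map G ` (U \<inter> set_inv G V)) x)" if "x \<in> space M" for x
  proof (rule convolution_sum_at_unit[OF S _ _ f g])
    show "U \<subseteq> arrows G" if "U \<in> S" for U
      by (rule bisection_arrows) (use that S(2) in blast)
    show "V \<subseteq> arrows G" if "V \<in> T" for V
      by (rule bisection_arrows) (use that T in blast)
    show "x \<in> units G"
      using that by (simp add: space_M)
  qed
  ultimately show ?thesis
    by (subst has_bochner_integral_cong[OF refl _ refl])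
qed

lemma integrable_convolution:
  assumes "f \<in> groupoid_algebra G" "g \<in> groupoid_algebra G"
  shows "integrable M (convolution G f g)"
proof -
  obtain S c where S: "finite S" "S \<subseteq> compact_bisections G"
    and f: "f = (\<lambda>\<gamma>. \<Sum>U\<in>S. c U * indicator U \<gamma>)"
    by (rule groupoid_algebra_representation[OF assms(1)])
  obtain T d where T: "finite T" "T \<subseteq> compact_bisections G"
    and g: "g = (\<lambda>\<gamma>. \<Sum>U\<in>T. d U * indicator U \<gamma>)"
    by (rule groupoid_algebra_representation[OF assms(2)])
  show ?thesis
    by (rule integrable.intros[OF has_integral_convolution[OF S T(2) f g]])
qed

text \<open>Inversion carries \<open>U \<inter> set_inv G V\<close> onto
  \<open>V \<inter> set_inv G U\<close>, so the range of the second is the domain of the first.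
  Invariance of the measure then matches the two double sums term by term.\<close>

lemma integral_convolution_commute:
  assumes "f \<in> groupoid_algebra G" "g \<in> groupoid_algebra G"
  shows "integral\<^sup>L M (convolution G f g) = integral\<^sup>L M (convolution G g f)"
proof -
  obtain S c where S: "finite S" "S \<subseteq> compact_bisections G"
    and f: "f = (\<lambda>\<gamma>. \<Sum>U\<in>S. c U * indicator U \<gamma>)"
    by (rule groupoid_algebra_representation[OF assms(1)])
  obtain T d where T: "finite T" "T \<subseteq> compact_bisections G"
    and g: "g = (\<lambda>\<gamma>. \<Sum>U\<in>T. d U * indicator U \<gamma>)"
    by (rule groupoid_algebra_representation[OF assms(2)])
  have sym: "measure M (ran_map G ` (U \<inter> set_inv G V)) = measure M (ran_map G ` (V \<inter> set_inv G U))"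
    if "U \<in> S" "V \<in> T" for U V
  proof -
    have UV: "U \<in> compact_bisections G" "V \<in> compact_bisections G"
      using that S T by auto
    have arr: "U \<inter> set_inv G V \<subseteq> arrows G" "U \<subseteq> arrows G" "V \<subseteq> arrows G"
      using bisection_arrows[OF UV(1)] bisection_arrows[OF UV(2)] by auto
    have "set_inv G (U \<inter> set_inv G V) = V \<inter> set_inv G U"
    proof (rule equalityI)
      show "set_inv G (U \<inter> set_inv G V) \<subseteq> V \<inter> set_inv G U"
      proof
        fix v assume "v \<in> set_inv G (U \<inter> set_inv G V)"
        then obtain u where u: "v = ginv G u" "u \<in> U" "u \<in> set_inv G V"
          unfolding set_inv_def[of G "U \<inter> _"] by blast
        have "v \<in> V"
          using u(3) mem_set_inv[OF arr(3), of u] u(2) arr(2) unfolding u(1) by blast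
        then show "v \<in> V \<inter> set_inv G U"
          using u(1,2) by (simp add: set_inv_def)
      qed
      show "V \<inter> set_inv G U \<subseteq> set_inv G (U \<inter> set_inv G V)"
      proof
        fix v assume v: "v \<in> V \<inter> set_inv G U"
        then have "v \<in> arrows G"
          using arr by blast
        moreover have "ginv G v \<in> U"
          using v mem_set_inv[OF arr(2) \<open>v \<in> arrows G\<close>] by blast
        moreover have "ginv G v \<in> set_inv G V"
          using v by (auto simp: set_inv_def)
        ultimately show "v \<in> set_inv G (U \<inter> set_inv G V)"
          using mem_set_inv[OF arr(1)] by blast
      qed
    qed
    moreover have "U \<inter> set_inv G V \<in> open_bisections G"
      using UV(1) openin_inter_set_inv[OF UV]
      by (intro open_bisection_subset[OF _ _ Int_lower1]) (simp_all add: compact_bisections_def)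
    ultimately show ?thesis
      using measure_dom_eq_ran[of "U \<inter> set_inv G V"] ran_set_inv[OF arr(1)] by simp
  qed
  have "integral\<^sup>L M (convolution G f g) =
      (\<Sum>U\<in>S. \<Sum>V\<in>T. c U * d V * complex_of_real (measure M (ran_map G ` (U \<inter> set_inv G V))))"
    by (rule has_bochner_integral_integral_eq[OF has_integral_convolution[OF S T(2) f g]])
  also have "\<dots> = (\<Sum>V\<in>T. \<Sum>U\<in>S. c U * d V * complex_of_real (measure M (ran_map G ` (U \<inter> set_inv G V))))"
    by (rule sum.swap)
  also have "\<dots> = (\<Sum>V\<in>T. \<Sum>U\<in>S. d V * c U * complex_of_real (measure M (ran_map G ` (V \<inter> set_inv G U))))"
  proof (intro sum.cong refl)
    fix V U assume "V \<in> T" "U \<in> S"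
    from sym[OF this(2,1)] show "c U * d V * complex_of_real (measure M (ran_map G ` (U \<inter> set_inv G V))) =
        d V * c U * complex_of_real (measure M (ran_map G ` (V \<inter> set_inv G U)))"
      by simp
  qed
  also have "\<dots> = integral\<^sup>L M (convolution G g f)"
    by (rule has_bochner_integral_integral_eq[OF has_integral_convolution[OF T S(2) g f], symmetric])
  finally show ?thesis .
qed

text \<open>Since the measure lives on the units, \<open>U\<close> may be replaced by
  \<open>U \<inter> units G\<close>. That set is open, lies in a compact bisection and is its own
  range image, so it has finite measure.\<close>

lemma integrable_algebra:
  assumes "f \<in> groupoid_algebra G"
  shows "integrable M f"
proof -
  obtain S c where S: "finite S" "S \<subseteq> compact_bisections G"
    and f: "f = (\<lambda>\<gamma>. \<Sum>U\<in>S. c U * indicator U \<gamma>)"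
    by (rule groupoid_algebra_representation[OF assms])
  have "integrable M (indicator U :: 'a \<Rightarrow> complex)" if "U \<in> S" for U
  proof -
    have U: "U \<in> compact_bisections G"
      using that S by auto
    have o: "openin (topol G) (U \<inter> units G)"
      using U openin_units by (auto simp: compact_bisections_def open_bisections_def)
    have "ran_map G ` (U \<inter> units G) = U \<inter> units G"
      using ran_unit by force
    then have "has_bochner_integral M (indicator (U \<inter> units G)) (complex_of_real (measure M (U \<inter> units G)))"
      using ran_image_finite[OF U o Int_lower1] by (intro has_bochner_integral_complex_indicator) simp_all
    then have "integrable M (indicator (U \<inter> units G) :: 'a \<Rightarrow> complex)"
      by (rule integrable.intros)
    moreover have "indicator (U \<inter> units G) x = (indicator U x :: complex)" if "x \<in> space M" for x
      using that space_M by (simp add: indicator_def)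
    ultimately show ?thesis
      using Bochner_Integration.integrable_cong[OF refl, of M "indicator (U \<inter> units G) :: 'a \<Rightarrow> complex"]
      by blast
  qed
  then show ?thesis
    unfolding f by (intro Bochner_Integration.integrable_sum integrable_mult_right)
qed

lemma integral_convolution_star:
  "integral\<^sup>L M (convolution G f (involution G f)) = complex_of_real (integral\<^sup>L M (fiber_energy G f))"
proof -
  have "integral\<^sup>L M (convolution G f (involution G f)) = (\<integral>x. complex_of_real (fiber_energy G f x) \<partial>M)"
    by (rule Bochner_Integration.integral_cong[OF refl]) (simp add: convolution_star_at_unit space_M)
  then show ?thesis
    by simp
qed

lemma integrable_fiber_energy:
  assumes "f \<in> groupoid_algebra G"
  shows "integrable M (fiber_energy G f)"
proof -
  have "integrable M (\<lambda>x. Re (convolution G f (involution G f) x))"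
    by (intro integrable_Re integrable_convolution assms groupoid_algebra_involution)
  moreover have "integrable M (\<lambda>x. Re (convolution G f (involution G f) x)) \<longleftrightarrow>
      integrable M (fiber_energy G f)"
    by (rule Bochner_Integration.integrable_cong[OF refl])
       (simp add: convolution_star_at_unit space_M)
  ultimately show ?thesis
    by blast
qed

text \<open>A unit is the range of an arrow in the support exactly if its fibre is nonempty. This
  exhibits the range of the support as the set where an integrable function is nonzero, hence as a
  measurable set.\<close>

lemma ran_supp_eq:
  assumes "f \<in> groupoid_algebra G"
  shows "ran_map G ` supp G f = {x \<in> space M. fiber_energy G f x \<noteq> 0}"
  unfolding fiber_energy_eq_0_iff[OF assms] space_M
  using ran_in_units by (auto simp: fiber_def supp_def)

lemma ran_supp_measurable:
  assumes "f \<in> groupoid_algebra G"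
  shows "ran_map G ` supp G f \<in> sets M"
  unfolding ran_supp_eq[OF assms]
  using borel_measurable_integrable[OF integrable_fiber_energy[OF assms]] by measurable

lemma integral_fiber_energy_eq_0:
  assumes f: "f \<in> groupoid_algebra G" and "integral\<^sup>L M (fiber_energy G f) = 0"
  shows "emeasure M (ran_map G ` supp G f) = 0"
proof -
  have "AE x in M. fiber_energy G f x = 0"
    using integral_nonneg_eq_0_iff_AE[OF integrable_fiber_energy[OF f]] assms(2)
    by (simp add: fiber_energy_nonneg)
  then show ?thesis
    using AE_iff_measurable[OF ran_supp_measurable[OF f] ran_supp_eq[OF f, symmetric]] by simp
qed

lemma groupoid_trace_integral: "groupoid_trace G (integral\<^sup>L M)"
  unfolding groupoid_trace_def is_trace_def
proof (intro conjI ballI allI)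
  fix f g assume "f \<in> groupoid_algebra G" "g \<in> groupoid_algebra G"
  then show "integral\<^sup>L M (f + g) = integral\<^sup>L M f + integral\<^sup>L M g"
    and "integral\<^sup>L M (convolution G f g) = integral\<^sup>L M (convolution G g f)"
    using integrable_algebra by (simp_all add: plus_fun_def integral_convolution_commute)
next
  fix c f
  show "integral\<^sup>L M (fun_scale c f) = c * integral\<^sup>L M f"
    by (simp add: fun_scale_def)
next
  fix f
  \<comment> \<open>Units are their own inverses, so on the unit space the involution is plain
    complex conjugation.\<close>
  have "integral\<^sup>L M (involution G f) = (\<integral>x. cnj (f x) \<partial>M)"
    using units_subset_arrows by (intro Bochner_Integration.integral_cong[OF refl]) (auto simp: space_M involution_def inv_unit)
  then show "integral\<^sup>L M (involution G f) = cnj (integral\<^sup>L M f)"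
    by simp
next
  fix f
  show "0 \<le> integral\<^sup>L M (convolution G f (involution G f))"
    by (simp add: integral_convolution_star fiber_energy_nonneg less_eq_complex_def
        Bochner_Integration.integral_nonneg)
qed

lemma contractive_trace_integral: "contractive_trace G (integral\<^sup>L M)"
  unfolding contractive_trace_def integral_convolution_star
proof (intro ballI)
  fix f U assume f: "f \<in> groupoid_algebra G" and "U \<in> compact_bisections G"
  then have "U \<in> open_bisections G"
    by (simp add: compact_bisections_def)
  then have "integral\<^sup>L M (fiber_energy G (convolution G f (indicator U))) \<le> integral\<^sup>L M (fiber_energy G f)"
    by (intro integral_mono'[OF integrable_fiber_energy[OF f]] fiber_energy_convolution_indicator[OF f]
        fiber_energy_nonneg)
  then show "complex_of_real (integral\<^sup>L M (fiber_energy G (convolution G f (indicator U))))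
      \<le> complex_of_real (integral\<^sup>L M (fiber_energy G f))"
    by (simp add: less_eq_complex_def)
qed

end

section \<open>The implications between the four statements\<close>

context ample_groupoid
begin

lemma strongly_faithful_imp_trace:
  assumes "strongly_faithful_mean G \<mu>"
  shows "\<exists>\<tau>. groupoid_trace G \<tau> \<and> faithful_trace G \<tau> \<and> contractive_trace G \<tau>"
proof -
  obtain M where M: "invariant_measure G M"
    and pos: "\<And>f. f \<in> groupoid_algebra G \<Longrightarrow> f \<noteq> 0 \<Longrightarrow> emeasure M (ran_map G ` supp G f) > 0"
    using assms unfolding strongly_faithful_mean_def by blast
  interpret invariant_measure_groupoid G M
    by unfold_locales (rule M)
  have "faithful_trace G (integral\<^sup>L M)"
    unfolding faithful_trace_def integral_convolution_star
  proof (intro ballI impI)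
    fix f assume f: "f \<in> groupoid_algebra G" and "complex_of_real (integral\<^sup>L M (fiber_energy G f)) = 0"
    then have "emeasure M (ran_map G ` supp G f) = 0"
      by (intro integral_fiber_energy_eq_0) simp_all
    then show "f = 0"
      using pos[OF f] by fastforce
  qed
  then show ?thesis
    using groupoid_trace_integral contractive_trace_integral by blast
qed

text \<open>For a compact open set \<open>U\<close> of units, the indicator is a self-adjoint
  idempotent, so its trace has the form treated by positivity and faithfulness. Invariance is the
  trace identity for the indicators of a bisection and of its inverse.\<close>

lemma faithful_trace_imp_mean:
  assumes tr: "groupoid_trace G \<tau>" and faithful: "faithful_trace G \<tau>"
  shows "\<exists>\<mu>. invariant_mean G \<mu> \<and> faithful_mean G \<mu>"
proof -
  define \<mu> where "\<mu> U = Re (\<tau> (indicator U))" for U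
  have add: "\<tau> (f + g) = \<tau> f + \<tau> g"
    and commute: "\<tau> (convolution G f g) = \<tau> (convolution G g f)"
    and pos: "0 \<le> \<tau> (convolution G f (involution G f))"
    if "f \<in> groupoid_algebra G" "g \<in> groupoid_algebra G" for f g
    using tr that unfolding groupoid_trace_def is_trace_def by blast+
  have unit_square: "convolution G (indicator U) (involution G (indicator U)) = indicator U"
    if "U \<in> compact_open_units G" for U
  proof -
    have U: "U \<subseteq> arrows G" "inj_on (ran_map G) U" "inj_on (dom_map G) U"
      using compact_open_units_bisection(1)[OF that] bisection_arrows
      by (auto simp: compact_bisections_def open_bisections_def)
    have "ran_map G ` U = U"
      using compact_open_units_bisection(2)[OF that] ran_unit by force
    then show ?thesis
      by (simp add: involution_indicator convolution_indicator set_mult_inv_right U)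
  qed
  have mem: "indicator U \<in> groupoid_algebra G" if "U \<in> compact_open_units G" for U
    using compact_open_units_bisection(1)[OF that] by (rule groupoid_algebra_indicator)
  have nonneg: "0 \<le> \<tau> (indicator U)" if "U \<in> compact_open_units G" for U
    using pos[OF mem[OF that] mem[OF that]] unit_square[OF that] by simp
  have "invariant_mean G \<mu>"
    unfolding invariant_mean_def
  proof (intro conjI ballI impI)
    fix U assume "U \<in> compact_open_units G"
    from nonneg[OF this] show "0 \<le> \<mu> U"
      by (simp add: \<mu>_def less_eq_complex_def)
  next
    fix U V assume U: "U \<in> compact_open_units G" and V: "V \<in> compact_open_units G"
      and disj: "U \<inter> V = {}"
    have "indicator (U \<union> V) = (indicator U + indicator V :: 'a \<Rightarrow> complex)"
      using disj by (auto simp: fun_eq_iff indicator_def)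
    then show "\<mu> (U \<union> V) = \<mu> U + \<mu> V"
      using add[OF mem[OF U] mem[OF V]] by (simp add: \<mu>_def)
  next
    fix U assume U: "U \<in> compact_bisections G"
    have inv: "set_inv G U \<in> compact_bisections G"
      by (rule set_inv_bisection[OF U])
    have "inj_on (ran_map G) U" "inj_on (ran_map G) (set_inv G U)"
      using U inv by (auto simp: compact_bisections_def open_bisections_def)
    then show "\<mu> (set_mult G (set_inv G U) U) = \<mu> (set_mult G U (set_inv G U))"
      using commute[OF groupoid_algebra_indicator[OF U] groupoid_algebra_indicator[OF inv]]
      by (simp add: \<mu>_def convolution_indicator)
  qed
  moreover have "faithful_mean G \<mu>"
    unfolding faithful_mean_def
  proof (intro ballI impI)
    fix U assume U: "U \<in> compact_open_units G" and "\<mu> U = 0"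
    \<comment> \<open>\<open>\<mu> U\<close> is only the real part, but the trace is nonnegative
      here and so has no imaginary part.\<close>
    then have "\<tau> (indicator U) = 0"
      using nonneg[OF U] by (simp add: \<mu>_def less_eq_complex_def complex_eq_iff)
    then have "\<tau> (convolution G (indicator U) (involution G (indicator U))) = 0"
      by (simp only: unit_square[OF U])
    then have "(indicator U :: 'a \<Rightarrow> complex) = 0"
      using faithful mem[OF U] unfolding faithful_trace_def by blast
    then show "U = {}"
      by (auto simp: fun_eq_iff indicator_def split: if_splits)
  qed
  ultimately show ?thesis
    by blast
qed

text \<open>In a Hausdorff groupoid compact open bisections are closed as well, so every member of
  the algebra is locally constant. Its support is then open and equals its own interior.\<close>

lemma Hausdorff_imp_singular_ideal:
  assumes "Hausdorff_space (topol G)"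
  shows "singular_ideal G = {0}"
proof -
  have "f = 0" if f: "f \<in> groupoid_algebra G" and int: "topol G interior_of supp G f = {}" for f
  proof -
    obtain S c where S: "finite S" "S \<subseteq> compact_bisections G"
      and rep: "f = (\<lambda>\<gamma>. \<Sum>U\<in>S. c U * indicator U \<gamma>)"
      by (rule groupoid_algebra_representation[OF f])
    have clopen: "openin (topol G) U" "closedin (topol G) U" if "U \<in> S" for U
      using that S(2) assms compactin_imp_closedin
      by (auto simp: compact_bisections_def open_bisections_def)
    have "openin (topol G) (supp G f)"
    proof (subst openin_subopen, intro ballI)
      fix \<gamma> assume \<gamma>: "\<gamma> \<in> supp G f"
      \<comment> \<open>A neighbourhood of \<open>\<gamma>\<close> on which all indicators from the
        representation keep their value at \<open>\<gamma>\<close>. The whole space is inserted so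
        that the intersection stays meaningful when \<open>S\<close> is empty.\<close>
      define T where "T = \<Inter>(insert (topspace (topol G))
        ((\<lambda>U. if \<gamma> \<in> U then U else topspace (topol G) - U) ` S))"
      have "openin (topol G) T"
        unfolding T_def using S(1) clopen by (intro openin_Inter) auto
      moreover have "\<gamma> \<in> T"
        using \<gamma> by (auto simp: T_def supp_def arrows_def)
      moreover have "T \<subseteq> supp G f"
      proof
        fix \<delta> assume \<delta>: "\<delta> \<in> T"
        have "indicator U \<delta> = (indicator U \<gamma> :: complex)" if "U \<in> S" for U
        proof -
          have "\<delta> \<in> (if \<gamma> \<in> U then U else topspace (topol G) - U)"
            using \<delta> that unfolding T_def by blast
          then show ?thesis
            by (simp add: indicator_def split: if_splits)
        qed
        then have "f \<delta> = f \<gamma>"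
          unfolding rep by (intro sum.cong refl) simp
        then show "\<delta> \<in> supp G f"
          using \<gamma> \<delta> by (simp add: supp_def T_def arrows_def)
      qed
      ultimately show "\<exists>T. openin (topol G) T \<and> \<gamma> \<in> T \<and> T \<subseteq> supp G f"
        by blast
    qed
    then have empty: "supp G f = {}"
      using int interior_of_openin by metis
    have "f \<gamma> = 0" for \<gamma>
    proof (cases "\<gamma> \<in> arrows G")
      case True
      then show ?thesis
        using empty by (auto simp: supp_def)
    next
      case False
      have "indicator U \<gamma> = (0 :: complex)" if "U \<in> S" for U
        using False bisection_arrows[of U] that S(2) by (auto simp: indicator_def)
      then show ?thesis
        by (simp add: rep)
    qed
    then show ?thesis
      by (simp add: fun_eq_iff)
  qed
  moreover have "0 \<in> singular_ideal G"
    by (simp add: singular_ideal_def supp_def groupoid_algebra_def complex_fun.span_zero)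
  ultimately show ?thesis
    by (auto simp: singular_ideal_def)
qed

lemma compact_open_units_basis:
  assumes "openin (unit_space G) U" "x \<in> U"
  shows "\<exists>C. openin (unit_space G) C \<and> compactin (unit_space G) C \<and> x \<in> C \<and> C \<subseteq> U"
proof -
  obtain \<U> where "\<U> \<subseteq> {K. openin (unit_space G) K \<and> compactin (unit_space G) K}" "\<Union>\<U> = U"
    using compact_open_basis[OF assms(1)] unfolding union_of_def by auto
  then show ?thesis
    using assms(2) by blast
qed

text \<open>A compact open part of the domain of \<open>U\<close> lifts to a compact bisection
  inside \<open>U\<close>, which moves it into the range of \<open>U\<close> without changing its
  mean. This bounds the measure of the domain by that of the range.\<close>

lemma invariant_mean_extension:
  assumes \<mu>: "invariant_mean G \<mu>"
  obtains M where "invariant_measure G M" "extends_mean G M \<mu>"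
proof -
  interpret E: compact_open_mean "unit_space G" \<mu>
    using \<mu> Hausdorff_units compact_open_units_basis
    by unfold_locales (auto simp: invariant_mean_def compact_open_units_def)
  have le: "E.open_value (dom_map G ` U) \<le> E.open_value (ran_map G ` U)" if U: "U \<in> open_bisections G" for U
  proof (rule E.open_value_le)
    fix C assume C: "C \<in> E.compact_opens" "C \<subseteq> dom_map G ` U"
    obtain W where W: "W \<in> compact_bisections G" "W \<subseteq> U" "dom_map G ` W = C"
      using compact_open_lift[OF U, of C] C by (auto simp: E.compact_opens_def)
    have W': "openin (topol G) W" "compactin (topol G) W" "inj_on (dom_map G) W" "inj_on (ran_map G) W"
      using W(1) by (auto simp: compact_bisections_def open_bisections_def)
    have "\<mu> (set_mult G (set_inv G W) W) = \<mu> (set_mult G W (set_inv G W))"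
      using \<mu> W(1) by (simp add: invariant_mean_def)
    then have "\<mu> C = \<mu> (ran_map G ` W)"
      using W' openin_arrows by (simp add: set_mult_inv_left set_mult_inv_right W(3))
    then show "ennreal (\<mu> C) \<le> E.open_value (ran_map G ` U)"
      using W' W(2) by (auto intro!: E.mean_le_open_value simp: E.compact_opens_def openin_ran compactin_ran)
  qed
  have "invariant_measure G E.extension"
    unfolding invariant_measure_def
  proof (intro conjI ballI E.radon_measure_extension)
    fix U assume U: "U \<in> open_bisections G"
    then have U': "openin (topol G) U" "inj_on (dom_map G) U" "inj_on (ran_map G) U" "U \<subseteq> arrows G"
      using openin_arrows by (auto simp: open_bisections_def)
    \<comment> \<open>The reverse inequality is \<open>le\<close> for the inverse bisection, whose
      domain and range are interchanged.\<close>
    have "E.open_value (dom_map G ` U) = E.open_value (ran_map G ` U)"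
      using le[OF U] le[OF set_inv_open_bisection[OF U]] U'(4)
      by (simp add: ran_set_inv dom_set_inv)
    then show "emeasure E.extension (set_mult G (set_inv G U) U) =
        emeasure E.extension (set_mult G U (set_inv G U))"
      using U' by (simp add: set_mult_inv_left set_mult_inv_right E.emeasure_extension_open
          openin_dom openin_ran)
  qed
  moreover have "extends_mean G E.extension \<mu>"
    by (simp add: extends_mean_def compact_open_units_def E.emeasure_extension_compact_open)
  ultimately show ?thesis
    by (rule that)
qed

lemma faithful_imp_strongly_faithful:
  assumes \<mu>: "invariant_mean G \<mu>" and faithful: "faithful_mean G \<mu>" and J: "singular_ideal G = {0}"
  shows "strongly_faithful_mean G \<mu>"
proof -
  obtain M where M: "invariant_measure G M" "extends_mean G M \<mu>"
    by (rule invariant_mean_extension[OF \<mu>])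
  interpret invariant_measure_groupoid G M
    by unfold_locales (rule M(1))
  have "emeasure M (ran_map G ` supp G f) > 0" if f: "f \<in> groupoid_algebra G" "f \<noteq> 0" for f
  proof -
    let ?I = "topol G interior_of supp G f"
    have "?I \<noteq> {}"
      using f J by (auto simp: singular_ideal_def)
    then obtain x where x: "x \<in> ran_map G ` ?I"
      by blast
    \<comment> \<open>Faithfulness of the mean speaks only of compact open sets, so one is placed
      inside the range of the interior of the support, which is open because the range map is
      open.\<close>
    obtain C where C: "openin (unit_space G) C" "compactin (unit_space G) C" "x \<in> C" "C \<subseteq> ran_map G ` ?I"
      using compact_open_units_basis[OF openin_ran[OF openin_interior_of] x] by blast
    have C': "C \<in> compact_open_units G"
      using C by (simp add: compact_open_units_def)
    have "\<mu> C \<noteq> 0" "0 \<le> \<mu> C"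
      using faithful \<mu> C' C(3) by (auto simp: faithful_mean_def invariant_mean_def)
    then have "0 < emeasure M C"
      using M(2) C' by (simp add: extends_mean_def)
    also have "\<dots> \<le> emeasure M (ran_map G ` supp G f)"
      using C(4) interior_of_subset[of "topol G" "supp G f"]
      by (intro emeasure_mono ran_supp_measurable[OF f(1)]) auto
    finally show ?thesis .
  qed
  then show ?thesis
    using M unfolding strongly_faithful_mean_def by blast
qed

end

theorem theorem7p6:
  fixes G :: "'a tgroupoid"
  assumes "ample_groupoid G"
  defines "S1 \<equiv> \<exists>\<mu>. invariant_mean G \<mu> \<and> faithful_mean G \<mu>"
    and "S2 \<equiv> \<exists>\<mu>. invariant_mean G \<mu> \<and> strongly_faithful_mean G \<mu>"
    and "S3 \<equiv> \<exists>\<tau>. groupoid_trace G \<tau> \<and> faithful_trace G \<tau> \<and> contractive_trace G \<tau>"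
    and "S4 \<equiv> \<exists>\<tau>. groupoid_trace G \<tau> \<and> faithful_trace G \<tau>"
  shows "(S2 \<longrightarrow> S3) \<and> (S3 \<longrightarrow> S4) \<and> (S4 \<longrightarrow> S1) \<and>
    (Hausdorff_space (topol G) \<or> singular_ideal G = {0} \<longrightarrow>
      (S1 \<longleftrightarrow> S2) \<and> (S2 \<longleftrightarrow> S3) \<and> (S3 \<longleftrightarrow> S4))"
proof -
  interpret ample_groupoid G
    by fact
  have 23: "S2 \<longrightarrow> S3"
    unfolding S2_def S3_def using strongly_faithful_imp_trace by blast
  have 34: "S3 \<longrightarrow> S4"
    unfolding S3_def S4_def by blast
  have 41: "S4 \<longrightarrow> S1"
    unfolding S4_def S1_def using faithful_trace_imp_mean by blast
  \<comment> \<open>This implication closes the cycle formed with \<open>23\<close>,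
    \<open>34\<close> and \<open>41\<close>, which makes all four statements equivalent.\<close>
  have 12: "S1 \<longrightarrow> S2" if "Hausdorff_space (topol G) \<or> singular_ideal G = {0}"
  proof -
    have J: "singular_ideal G = {0}"
      using that Hausdorff_imp_singular_ideal by (elim disjE)
    show ?thesis
      unfolding S1_def S2_def using faithful_imp_strongly_faithful[OF _ _ J] by blast
  qed
  show ?thesis
  proof (intro conjI 23 34 41 impI)
    assume "Hausdorff_space (topol G) \<or> singular_ideal G = {0}"
    then have "S1 \<longrightarrow> S2"
      by (rule 12)
    with 23 34 41 show "S1 \<longleftrightarrow> S2" "S2 \<longleftrightarrow> S3" "S3 \<longleftrightarrow> S4"
      by iprover+
  qed
qed

end
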